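(* Let $\mathcal{A}$ and $\mathcal{B}$ be instances such that $\mathcal{A}$ is MSO-interpretable in $\mathcal{B}$ and $\mathrm{pw}(\mathcal{B})\in\mathbb{N}$. Then $\mathrm{pw}(\mathcal{A})\in\mathbb{N}$.
   Context: Instances: for a finite signature $\Sigma$ of relation symbols with arities $\mathrm{ar}(R)\ge1$ (containing the unary predicate $\top$) and a finite set $\mathrm{Cnst}$ of constants, an instance is a countable set of atoms $R(t_1,\dots,t_k)$, $R\in\Sigma$, whose terms are constants from $\mathrm{Cnst}$ or nulls; $\mathrm{adom}(\mathcal I)$ is its set of terms. Instances are isomorphic if there is a bijection of terms that is the identity on constants and maps atoms onto atoms. $\mathrm{ar}(\Sigma)$ is the maximal arity in $\Sigma$. MSO-interpretations: for signatures/constant sets $(\Sigma,\mathrm{Cnst})$ and $(\Sigma',\mathrm{Cnst}')$, an MSO-interpretation $\mathfrak I$ is a sequence of MSO formulas over $(\Sigma,\mathrm{Cnst})$: one formula $\varphi_R(x_1,\dots,x_{\mathrm{ar}(R)})$ for each $R\in\Sigma'\cup\{\top\}$, one formula $\varphi_c(x_1)$ for each $c\in\mathrm{Cnst}'$, and one formula $\varphi_=(x_1,x_2)$. For an instance $\mathcal B$ over $(\Sigma,\mathrm{Cnst})$ let $D=\{t\in\mathrm{adom}(\mathcal B)\mid\mathcal B\models\varphi_\top(t)\}$ and let $f:D\to\mathbf N\cup\mathrm{Cnst}'$ ($\mathbf N$ the set of nulls) be a fixed function with $f(t)=f(t')$ iff $\mathcal B\models\varphi_=(t,t')$ and $f(t)=c$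 iff $\mathcal B\models\varphi_c(t)$; if no such $f$ exists $\mathfrak I(\mathcal B)$ is undefined, otherwise $\mathfrak I(\mathcal B)=\bigcup_{R\in\Sigma'\cup\{\top\}}\{R(f(\vec t))\mid\mathcal B\models\varphi_R(\vec t),\ \vec t\in D^{\mathrm{ar}(R)}\}$. $\mathcal A$ is MSO-interpretable in $\mathcal B$ if $\mathcal A\cong\mathfrak I(\mathcal B)$ for some MSO-interpretation $\mathfrak I$. Partitionwidth: let $\mathbb L$ be a finite set of colors, each with an arity $\mathrm{ar}(\lambda)\in\mathbb N_+$, containing distinguished colors $o_i$ of arity $i$ for $1\le i\le\mathrm{ar}(\Sigma)$. For a $k$-tuple $\vec a$, an $m$-tuple $\vec b$ and $I\subsetneq\{1,\dots,k+m\}$ with $|I|=k$, $\vec a\,{+}{+}_I\,\vec b$ is the $(k+m)$-tuple carrying $a_1,\dots,a_k$ (in order) at the positions in $I$ and $b_1,\dots,b_m$ (in order) at the other positions; for sets of tuples, $A\,{+}{+}_I\,B$ is defined elementwise. Instructions over $(\mathbb L,\Sigma)$: $\mathrm{Add}(\kappa,\mu,I\to\lambda)$ with $\mathrm{ar}(\kappa)+\mathrm{ar}(\mu)=\mathrm{ar}(\lambda)$, $I\subsetneq\{1,\dots,\mathrm{ar}(\lambda)\}$, $|I|=\mathrm{ar}(\kappa)$; $\mathrm{Recol}^i(\kappa\to\lambda)$ with $i\in\{0,1\}$, $\mathrm{ar}(\kappa)=\mathrm{ar}(\lambda)$; $\mathrm{RAdd}(\kappa,\mu,I\to R)$ with $R\in\Sigma$,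 $\mathrm{ar}(\kappa)+\mathrm{ar}(\mu)=\mathrm{ar}(R)$, $I\subsetneq\{1,\dots,\mathrm{ar}(R)\}$, $|I|=\mathrm{ar}(\kappa)$; $\mathrm{Mat}^i(\kappa\to R)$ with $i\in\{0,1\}$, $\mathrm{ar}(\kappa)=\mathrm{ar}(R)$. Instructions $\mathrm{Add}(\kappa,\mu,I\to\lambda),\mathrm{Add}(\kappa,\mu,I\to\lambda')$ resp. $\mathrm{Recol}^i(\kappa\to\lambda),\mathrm{Recol}^i(\kappa\to\lambda')$ with $\lambda\neq\lambda'$ are incompatible. A well-decorated tree $\mathcal T$ assigns to each node $s\in\{0,1\}^*$ of the infinite binary tree (children $s0,s1$) a set of decorators from $\{*\}\cup\mathrm{Cnst}\cup\{\text{instructions}\}$ such that: a node decorated by $*$ or a constant (a pseudoleaf) has no other decorator; proper descendants of pseudoleaves are undecorated; each constant decorates at most one node; no node carries two incompatible instructions. The entities of $s$ are the nodes $ss'$ decorated by $*$ and the constants decorating some $ss'$. Sets $\mathrm{col}_s(\lambda)$ of tuples of entities are defined recursively: if $s$ is decorated by $c\in\mathrm{Cnst}$ (resp. $*$), $\mathrm{col}_s(o_i)$ is the $i$-tuple $(c,\dots,c)$ (resp. $(s,\dots,s)$) and $\mathrm{col}_s(\lambda)=\emptyset$ for other $\lambda$; otherwise $\mathrm{col}_s(\lambda)$ is the union of $\mathrm{col}_{s0}(\kappa)\,{+}{+}_I\,\mathrm{col}_{s1}(\mu)$ over all $\mathrm{Add}(\kappa,\mu,I\to\lambda)$ at $s$,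 of $\mathrm{col}_{si}(\kappa)$ over all $\mathrm{Recol}^i(\kappa\to\lambda)$ at $s$, and, for each $i\in\{0,1\}$, of $\mathrm{col}_{si}(\lambda)$ unless $s$ carries some $\mathrm{Recol}^i(\lambda\to\kappa)$. $\mathrm{Atoms}_s$ is $\{\top(c)\}$ resp. $\{\top(s)\}$ at pseudoleaves, and otherwise the set of all $R(\vec e)$ with $\vec e\in\mathrm{col}_{s0}(\kappa)\,{+}{+}_I\,\mathrm{col}_{s1}(\mu)$ for some $\mathrm{RAdd}(\kappa,\mu,I\to R)$ at $s$, or $\vec e\in\mathrm{col}_{si}(\kappa)$ for some $\mathrm{Mat}^i(\kappa\to R)$ at $s$. The instance represented by $\mathcal T$ is $\bigcup_s\mathrm{Atoms}_s$. The partitionwidth $\mathrm{pw}(\mathcal I)$ is the least $|\mathbb L|$ such that $\mathcal I$ is isomorphic to the instance represented by some well-decorated tree over $(\mathbb L,\mathrm{Cnst},\Sigma)$, and $\infty$ if there is none. *)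

theory Defs
  imports Main "HOL-Library.Extended_Nat" "HOL-Library.Countable_Set"
begin

subsection \<open>Signatures, instances, isomorphism\<close>

record 'r signature =
  rels :: "'r set"
  arity :: "'r \<Rightarrow> nat"
  top_sym :: 'r

definition is_signature :: "'r signature \<Rightarrow> bool" where
  "is_signature \<Sigma> \<longleftrightarrow>
     finite (rels \<Sigma>) \<and> (\<forall>R\<in>rels \<Sigma>. 1 \<le> arity \<Sigma> R) \<and>
     top_sym \<Sigma> \<in> rels \<Sigma> \<and> arity \<Sigma> (top_sym \<Sigma>) = 1"

definition max_arity :: "'r signature \<Rightarrow> nat" where
  "max_arity \<Sigma> = Max (arity \<Sigma> ` rels \<Sigma>)"

datatype ('c, 'n) trm = Const 'c | Null 'n

text \<open>The countably infinite set of nulls of arbitrary instances. Instances represented by trees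
  use tree nodes as nulls instead, so the type of nulls is a parameter of terms.\<close>

type_synonym null = nat

text \<open>The pair \<open>(R, [t\<^sub>1, \<dots>, t\<^sub>k])\<close> is the atom \<open>R(t\<^sub>1, \<dots>, t\<^sub>k)\<close>.\<close>

type_synonym ('r, 'c, 'n) atom = "'r \<times> ('c, 'n) trm list"
type_synonym ('r, 'c, 'n) atoms = "('r, 'c, 'n) atom set"

definition is_instance :: "'r signature \<Rightarrow> 'c set \<Rightarrow> ('r, 'c, 'n) atoms \<Rightarrow> bool" where
  "is_instance \<Sigma> C I \<longleftrightarrow>
     countable I \<and>
     (\<forall>(R, ts)\<in>I. R \<in> rels \<Sigma> \<and> length ts = arity \<Sigma> R \<and> set ts \<subseteq> Const ` C \<union> range Null)"

definition adom :: "('r, 'c, 'n) atoms \<Rightarrow> ('c, 'n) trm set" where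
  "adom I = (\<Union>(R, ts)\<in>I. set ts)"

text \<open>All constants are added to the domain and codomain of the bijection, so that being the
  identity on constants also forces nulls to be mapped to nulls.\<close>

definition isomorphic :: "('r, 'c, 'n) atoms \<Rightarrow> ('r, 'c, 'm) atoms \<Rightarrow> bool" where
  "isomorphic I J \<longleftrightarrow>
     (\<exists>h. bij_betw h (adom I \<union> range Const) (adom J \<union> range Const) \<and>
          (\<forall>c. h (Const c) = Const c) \<and>
          (\<lambda>(R, ts). (R, map h ts)) ` I = J)"

subsection \<open>Monadic second-order logic\<close>

datatype 'c mso_term = V nat | K 'c

datatype ('r, 'c) mso =
    Rel 'r "'c mso_term list"
  | Equal "'c mso_term" "'c mso_term"
  | Elem "'c mso_term" nat
  | Neg "('r, 'c) mso"
  | Conj "('r, 'c) mso" "('r, 'c) mso"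
  | Exists nat "('r, 'c) mso"
  | ExistsSet nat "('r, 'c) mso"

primrec term_over :: "'c set \<Rightarrow> 'c mso_term \<Rightarrow> bool" where
  "term_over C (V x) \<longleftrightarrow> True"
| "term_over C (K c) \<longleftrightarrow> c \<in> C"

primrec mso_over :: "'r signature \<Rightarrow> 'c set \<Rightarrow> ('r, 'c) mso \<Rightarrow> bool" where
  "mso_over \<Sigma> C (Rel R us) \<longleftrightarrow>
     R \<in> rels \<Sigma> \<and> length us = arity \<Sigma> R \<and> (\<forall>u\<in>set us. term_over C u)"
| "mso_over \<Sigma> C (Equal u v) \<longleftrightarrow> term_over C u \<and> term_over C v"
| "mso_over \<Sigma> C (Elem u X) \<longleftrightarrow> term_over C u"
| "mso_over \<Sigma> C (Neg \<phi>) \<longleftrightarrow> mso_over \<Sigma> C \<phi>"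
| "mso_over \<Sigma> C (Conj \<phi> \<psi>) \<longleftrightarrow> mso_over \<Sigma> C \<phi> \<and> mso_over \<Sigma> C \<psi>"
| "mso_over \<Sigma> C (Exists x \<phi>) \<longleftrightarrow> mso_over \<Sigma> C \<phi>"
| "mso_over \<Sigma> C (ExistsSet X \<phi>) \<longleftrightarrow> mso_over \<Sigma> C \<phi>"

primrec term_vars :: "'c mso_term \<Rightarrow> nat set" where
  "term_vars (V x) = {x}"
| "term_vars (K c) = {}"

primrec free_vars :: "('r, 'c) mso \<Rightarrow> nat set" where
  "free_vars (Rel R us) = (\<Union>u\<in>set us. term_vars u)"
| "free_vars (Equal u v) = term_vars u \<union> term_vars v"
| "free_vars (Elem u X) = term_vars u"
| "free_vars (Neg \<phi>) = free_vars \<phi>"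
| "free_vars (Conj \<phi> \<psi>) = free_vars \<phi> \<union> free_vars \<psi>"
| "free_vars (Exists x \<phi>) = free_vars \<phi> - {x}"
| "free_vars (ExistsSet X \<phi>) = free_vars \<phi>"

primrec free_set_vars :: "('r, 'c) mso \<Rightarrow> nat set" where
  "free_set_vars (Rel R us) = {}"
| "free_set_vars (Equal u v) = {}"
| "free_set_vars (Elem u X) = {X}"
| "free_set_vars (Neg \<phi>) = free_set_vars \<phi>"
| "free_set_vars (Conj \<phi> \<psi>) = free_set_vars \<phi> \<union> free_set_vars \<psi>"
| "free_set_vars (Exists x \<phi>) = free_set_vars \<phi>"
| "free_set_vars (ExistsSet X \<phi>) = free_set_vars \<phi> - {X}"

primrec term_val :: "(nat \<Rightarrow> ('c, 'n) trm) \<Rightarrow> 'c mso_term \<Rightarrow> ('c, 'n) trm" where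
  "term_val \<alpha> (V x) = \<alpha> x"
| "term_val \<alpha> (K c) = Const c"

text \<open>Quantifiers range over the elements and the arbitrary subsets of the active domain;
  constants denote themselves.\<close>

primrec sat :: "('r, 'c, 'n) atoms \<Rightarrow> (nat \<Rightarrow> ('c, 'n) trm) \<Rightarrow> (nat \<Rightarrow> ('c, 'n) trm set) \<Rightarrow>
    ('r, 'c) mso \<Rightarrow> bool" where
  "sat I \<alpha> \<beta> (Rel R us) \<longleftrightarrow> (R, map (term_val \<alpha>) us) \<in> I"
| "sat I \<alpha> \<beta> (Equal u v) \<longleftrightarrow> term_val \<alpha> u = term_val \<alpha> v"
| "sat I \<alpha> \<beta> (Elem u X) \<longleftrightarrow> term_val \<alpha> u \<in> \<beta> X"
| "sat I \<alpha> \<beta> (Neg \<phi>) \<longleftrightarrow> \<not> sat I \<alpha> \<beta> \<phi>"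
| "sat I \<alpha> \<beta> (Conj \<phi> \<psi>) \<longleftrightarrow> sat I \<alpha> \<beta> \<phi> \<and> sat I \<alpha> \<beta> \<psi>"
| "sat I \<alpha> \<beta> (Exists x \<phi>) \<longleftrightarrow> (\<exists>t\<in>adom I. sat I (\<alpha>(x := t)) \<beta> \<phi>)"
| "sat I \<alpha> \<beta> (ExistsSet X \<phi>) \<longleftrightarrow> (\<exists>S\<subseteq>adom I. sat I \<alpha> (\<beta>(X := S)) \<phi>)"

text \<open>The distinguished free variables \<open>x\<^sub>1, \<dots>, x\<^sub>k\<close> of a formula \<open>\<phi>(x\<^sub>1, \<dots>, x\<^sub>k)\<close> are
  \<open>V 0, \<dots>, V (k - 1)\<close>.\<close>

definition mso_formula :: "'r signature \<Rightarrow> 'c set \<Rightarrow> nat \<Rightarrow> ('r, 'c) mso \<Rightarrow> bool" where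
  "mso_formula \<Sigma> C k \<phi> \<longleftrightarrow>
     mso_over \<Sigma> C \<phi> \<and> free_vars \<phi> \<subseteq> {..<k} \<and> free_set_vars \<phi> = {}"

definition models :: "('r, 'c, 'n) atoms \<Rightarrow> ('r, 'c) mso \<Rightarrow> ('c, 'n) trm list \<Rightarrow> bool" where
  "models I \<phi> ts \<longleftrightarrow> sat I (\<lambda>i. ts ! i) (\<lambda>_. {}) \<phi>"

subsection \<open>MSO-interpretations\<close>

record ('r, 'c, 's, 'd) interp =
  fm_rel :: "'s \<Rightarrow> ('r, 'c) mso"
  fm_const :: "'d \<Rightarrow> ('r, 'c) mso"
  fm_eq :: "('r, 'c) mso"

definition mso_interpretation ::
  "'r signature \<Rightarrow> 'c set \<Rightarrow> 's signature \<Rightarrow> 'd set \<Rightarrow> ('r, 'c, 's, 'd) interp \<Rightarrow> bool" where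
  "mso_interpretation \<Sigma> C \<Sigma>' C' \<J> \<longleftrightarrow>
     (\<forall>R\<in>rels \<Sigma>' \<union> {top_sym \<Sigma>'}. mso_formula \<Sigma> C (arity \<Sigma>' R) (fm_rel \<J> R)) \<and>
     (\<forall>c\<in>C'. mso_formula \<Sigma> C 1 (fm_const \<J> c)) \<and>
     mso_formula \<Sigma> C 2 (fm_eq \<J>)"

definition interp_dom ::
  "'s signature \<Rightarrow> ('r, 'c, 's, 'd) interp \<Rightarrow> ('r, 'c, 'n) atoms \<Rightarrow> ('c, 'n) trm set" where
  "interp_dom \<Sigma>' \<J> B = {t \<in> adom B. models B (fm_rel \<J> (top_sym \<Sigma>')) [t]}"

definition interp_fun ::
  "'s signature \<Rightarrow> 'd set \<Rightarrow> ('r, 'c, 's, 'd) interp \<Rightarrow> ('r, 'c, 'n) atoms \<Rightarrow>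
   (('c, 'n) trm \<Rightarrow> ('d, null) trm) \<Rightarrow> bool" where
  "interp_fun \<Sigma>' C' \<J> B f \<longleftrightarrow>
     f ` interp_dom \<Sigma>' \<J> B \<subseteq> range Null \<union> Const ` C' \<and>
     (\<forall>t\<in>interp_dom \<Sigma>' \<J> B. \<forall>t'\<in>interp_dom \<Sigma>' \<J> B. f t = f t' \<longleftrightarrow> models B (fm_eq \<J>) [t, t']) \<and>
     (\<forall>t\<in>interp_dom \<Sigma>' \<J> B. \<forall>c\<in>C'. f t = Const c \<longleftrightarrow> models B (fm_const \<J> c) [t])"

definition interp_result ::
  "'s signature \<Rightarrow> 'd set \<Rightarrow> ('r, 'c, 's, 'd) interp \<Rightarrow> ('r, 'c, 'n) atoms \<Rightarrow>
   ('s, 'd, null) atoms option" where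
  "interp_result \<Sigma>' C' \<J> B =
     (if \<exists>f. interp_fun \<Sigma>' C' \<J> B f
      then let f = SOME f. interp_fun \<Sigma>' C' \<J> B f in
        Some (\<Union>R\<in>rels \<Sigma>' \<union> {top_sym \<Sigma>'}.
          {(R, map f ts) | ts. length ts = arity \<Sigma>' R \<and> set ts \<subseteq> interp_dom \<Sigma>' \<J> B \<and>
                               models B (fm_rel \<J> R) ts})
      else None)"

definition mso_interpretable ::
  "'r signature \<Rightarrow> 'c set \<Rightarrow> 's signature \<Rightarrow> 'd set \<Rightarrow>
   ('s, 'd, 'm) atoms \<Rightarrow> ('r, 'c, 'n) atoms \<Rightarrow> bool" where
  "mso_interpretable \<Sigma> C \<Sigma>' C' A B \<longleftrightarrow>
     (\<exists>\<J> A'. mso_interpretation \<Sigma> C \<Sigma>' C' \<J> \<and> interp_result \<Sigma>' C' \<J> B = Some A' \<and> isomorphic A A')"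

subsection \<open>Partitionwidth\<close>

record 'l coloring =
  colors :: "'l set"
  color_arity :: "'l \<Rightarrow> nat"
  leaf_color :: "nat \<Rightarrow> 'l"

text \<open>\<open>leaf_color L i\<close> is the distinguished color \<open>o\<^sub>i\<close>, meaningful only for \<open>i\<close> from 1 to the
  maximal arity.\<close>

definition is_coloring :: "'r signature \<Rightarrow> 'l coloring \<Rightarrow> bool" where
  "is_coloring \<Sigma> L \<longleftrightarrow>
     finite (colors L) \<and> (\<forall>\<kappa>\<in>colors L. 1 \<le> color_arity L \<kappa>) \<and>
     (\<forall>i\<in>{1..max_arity \<Sigma>}. leaf_color L i \<in> colors L \<and> color_arity L (leaf_color L i) = i)"

text \<open>Positions \<open>p\<close> in tuples are counted from 1; \<open>card (I \<inter> {1..<p})\<close> is the number of positions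
  before \<open>p\<close> that belong to \<open>I\<close>.\<close>

definition merge :: "nat set \<Rightarrow> 'a list \<Rightarrow> 'a list \<Rightarrow> 'a list" where
  "merge I as bs =
     map (\<lambda>p. if p \<in> I then as ! card (I \<inter> {1..<p}) else bs ! card ({1..<p} - I))
         [1..<Suc (length as + length bs)]"

text \<open>The index \<open>i \<in> {0, 1}\<close> of a child is a Boolean, with \<open>False\<close> for 0 and \<open>True\<close> for 1.\<close>

datatype ('l, 'r) instruction =
    Add 'l 'l "nat set" 'l
  | Recol bool 'l 'l
  | RAdd 'l 'l "nat set" 'r
  | Mat bool 'l 'r

primrec is_instruction :: "'r signature \<Rightarrow> 'l coloring \<Rightarrow> ('l, 'r) instruction \<Rightarrow> bool" where
  "is_instruction \<Sigma> L (Add \<kappa> \<mu> I \<nu>) \<longleftrightarrow>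
     {\<kappa>, \<mu>, \<nu>} \<subseteq> colors L \<and> color_arity L \<kappa> + color_arity L \<mu> = color_arity L \<nu> \<and>
     I \<subset> {1..color_arity L \<nu>} \<and> card I = color_arity L \<kappa>"
| "is_instruction \<Sigma> L (Recol i \<kappa> \<nu>) \<longleftrightarrow>
     {\<kappa>, \<nu>} \<subseteq> colors L \<and> color_arity L \<kappa> = color_arity L \<nu>"
| "is_instruction \<Sigma> L (RAdd \<kappa> \<mu> I R) \<longleftrightarrow>
     {\<kappa>, \<mu>} \<subseteq> colors L \<and> R \<in> rels \<Sigma> \<and> color_arity L \<kappa> + color_arity L \<mu> = arity \<Sigma> R \<and>
     I \<subset> {1..arity \<Sigma> R} \<and> card I = color_arity L \<kappa>"
| "is_instruction \<Sigma> L (Mat i \<kappa> R) \<longleftrightarrow>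
     \<kappa> \<in> colors L \<and> R \<in> rels \<Sigma> \<and> color_arity L \<kappa> = arity \<Sigma> R"

definition incompatible :: "('l, 'r) instruction \<Rightarrow> ('l, 'r) instruction \<Rightarrow> bool" where
  "incompatible x y \<longleftrightarrow>
     (\<exists>\<kappa> \<mu> I \<nu> \<nu>'. x = Add \<kappa> \<mu> I \<nu> \<and> y = Add \<kappa> \<mu> I \<nu>' \<and> \<nu> \<noteq> \<nu>') \<or>
     (\<exists>i \<kappa> \<nu> \<nu>'. x = Recol i \<kappa> \<nu> \<and> y = Recol i \<kappa> \<nu>' \<and> \<nu> \<noteq> \<nu>')"

datatype ('l, 'r, 'c) decorator = Star | DConst 'c | Instr "('l, 'r) instruction"

text \<open>The children of a node \<open>s\<close> are \<open>s @ [False]\<close> and \<open>s @ [True]\<close>.\<close>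

type_synonym node = "bool list"
type_synonym ('l, 'r, 'c) tree = "node \<Rightarrow> ('l, 'r, 'c) decorator set"

definition pseudoleaf :: "('l, 'r, 'c) tree \<Rightarrow> node \<Rightarrow> bool" where
  "pseudoleaf T s \<longleftrightarrow> Star \<in> T s \<or> (\<exists>c. DConst c \<in> T s)"

definition well_decorated ::
  "'l coloring \<Rightarrow> 'c set \<Rightarrow> 'r signature \<Rightarrow> ('l, 'r, 'c) tree \<Rightarrow> bool" where
  "well_decorated L C \<Sigma> T \<longleftrightarrow>
     (\<forall>s. T s \<subseteq> {Star} \<union> DConst ` C \<union> Instr ` {x. is_instruction \<Sigma> L x}) \<and>
     (\<forall>s. pseudoleaf T s \<longrightarrow> (\<exists>d. T s = {d})) \<and>
     (\<forall>s s'. pseudoleaf T s \<and> s' \<noteq> [] \<longrightarrow> T (s @ s') = {}) \<and>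
     (\<forall>c s s'. DConst c \<in> T s \<and> DConst c \<in> T s' \<longrightarrow> s = s') \<and>
     (\<forall>s x y. Instr x \<in> T s \<and> Instr y \<in> T s \<longrightarrow> \<not> incompatible x y)"

text \<open>\<open>colored \<Sigma> L T s \<kappa> e\<close> states that \<open>e\<close> belongs to \<open>col\<^sub>s(\<kappa>)\<close>. The recursion descends along
  possibly infinite branches. The inductive definition is its only solution consisting of tuples of
  entities, since each such tuple is broken up into pseudoleaves after finitely many steps.\<close>

inductive colored ::
  "'r signature \<Rightarrow> 'l coloring \<Rightarrow> ('l, 'r, 'c) tree \<Rightarrow> node \<Rightarrow> 'l \<Rightarrow> ('c, node) trm list \<Rightarrow> bool"
  for \<Sigma> L T where
  const: "DConst c \<in> T s \<Longrightarrow> i \<in> {1..max_arity \<Sigma>} \<Longrightarrow>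
    colored \<Sigma> L T s (leaf_color L i) (replicate i (Const c))"
| star: "Star \<in> T s \<Longrightarrow> i \<in> {1..max_arity \<Sigma>} \<Longrightarrow>
    colored \<Sigma> L T s (leaf_color L i) (replicate i (Null s))"
| add: "\<not> pseudoleaf T s \<Longrightarrow> Instr (Add \<kappa> \<mu> I \<nu>) \<in> T s \<Longrightarrow>
    colored \<Sigma> L T (s @ [False]) \<kappa> as \<Longrightarrow> colored \<Sigma> L T (s @ [True]) \<mu> bs \<Longrightarrow>
    colored \<Sigma> L T s \<nu> (merge I as bs)"
| recol: "\<not> pseudoleaf T s \<Longrightarrow> Instr (Recol i \<kappa> \<nu>) \<in> T s \<Longrightarrow>
    colored \<Sigma> L T (s @ [i]) \<kappa> e \<Longrightarrow> colored \<Sigma> L T s \<nu> e"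
| keep: "\<not> pseudoleaf T s \<Longrightarrow> (\<forall>\<kappa>. Instr (Recol i \<nu> \<kappa>) \<notin> T s) \<Longrightarrow>
    colored \<Sigma> L T (s @ [i]) \<nu> e \<Longrightarrow> colored \<Sigma> L T s \<nu> e"

definition atoms_at ::
  "'r signature \<Rightarrow> 'l coloring \<Rightarrow> ('l, 'r, 'c) tree \<Rightarrow> node \<Rightarrow> ('r, 'c, node) atoms" where
  "atoms_at \<Sigma> L T s =
     (if pseudoleaf T s
      then {(top_sym \<Sigma>, [Const c]) | c. DConst c \<in> T s} \<union> {a. a = (top_sym \<Sigma>, [Null s]) \<and> Star \<in> T s}
      else {(R, merge I as bs) | R I as bs. \<exists>\<kappa> \<mu>. Instr (RAdd \<kappa> \<mu> I R) \<in> T s \<and>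
              colored \<Sigma> L T (s @ [False]) \<kappa> as \<and> colored \<Sigma> L T (s @ [True]) \<mu> bs} \<union>
           {(R, e) | R e. \<exists>i \<kappa>. Instr (Mat i \<kappa> R) \<in> T s \<and> colored \<Sigma> L T (s @ [i]) \<kappa> e})"

definition represented ::
  "'r signature \<Rightarrow> 'l coloring \<Rightarrow> ('l, 'r, 'c) tree \<Rightarrow> ('r, 'c, node) atoms" where
  "represented \<Sigma> L T = (\<Union>s. atoms_at \<Sigma> L T s)"

text \<open>Colors are taken to be natural numbers, as a finite set of colors only matters up to renaming.
  The infimum of the empty set is \<open>\<infinity>\<close>.\<close>

definition partitionwidth :: "'r signature \<Rightarrow> 'c set \<Rightarrow> ('r, 'c, 'n) atoms \<Rightarrow> enat" where
  "partitionwidth \<Sigma> C I =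
     Inf {enat (card (colors L)) | (L :: nat coloring) T.
            is_coloring \<Sigma> L \<and> well_decorated L C \<Sigma> T \<and> isomorphic I (represented \<Sigma> L T)}"

end

theory Submission
  imports Defs
begin

text \<open>The proof is a composition argument. Fix a tree representing \<open>B\<close> and value all variables by
  sets of its leaves. A predicate of valuations is recognizable if it is decided by the type at the
  root, for some assignment of finitely many types to pairs of a node and a valuation such that the
  type at a node depends only on the part of the valuation below it, and only on the types at the
  two children unless the node is a leaf. Recognizable predicates are closed under the logical
  operations, the projection for a set quantifier being a subset construction; no acceptance
  condition on infinite branches is involved, since types are computed from the semantics and not
  by a run. Atomic formulas are recognizable since the instructions compute colors from colors.

  For an interpretation in \<open>B\<close>, one leaf is chosen for each element of the result. A tuple of chosen
  leaves below a node is colored by its types, so composition of types becomes \<open>Add\<close> and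
  \<open>Recol\<close> instructions, and all atoms are materialized at a new root.\<close>

subsection \<open>Merging tuples\<close>

text \<open>The difficulty lies in the shape of colors. They must describe tuples that are still
  incomplete, with entries in any positions, and a pseudoleaf admits no color other than
  \<open>o_i\<close>. Types therefore compose separately at each non-leaf node, by a composition
  that may vary with the node: instructions are chosen per node, so the tree may be arbitrarily
  irregular. Quantified elements and sets are absorbed into the types before any tuple is colored,
  so that only free variables correspond to tuple entries; constants of \<open>B\<close> act as
  fixed parameters. The identification made by the equality formula is undone by quantifying over
  all tuples of equivalent leaves. The representatives can then be chosen arbitrarily, since they
  limit only which leaves become entities and not the range of the quantifiers. The extra root is
  forced by \<open>Mat\<close>, which reads the colors of a child, and by pseudoleaves, which carry
  no instruction.\<close>

lemma bij_betw_rank: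
  fixes I :: "nat set"
  assumes "finite I" "0 \<notin> I"
  shows "bij_betw (\<lambda>p. card (I \<inter> {1..<p})) I {..<card I}"
proof -
  have less: "card (I \<inter> {1..<p}) < card (I \<inter> {1..<q})" if "p \<in> I" "p < q" for p q
  proof (rule psubset_card_mono)
    have "p \<noteq> 0" using that assms(2) by metis
    then have "p \<in> I \<inter> {1..<q}" "p \<notin> I \<inter> {1..<p}" using that by auto
    moreover have "I \<inter> {1..<p} \<subseteq> I \<inter> {1..<q}" using that by auto
    ultimately show "I \<inter> {1..<p} \<subset> I \<inter> {1..<q}" by blast
  qed (use assms in auto)
  have inj: "inj_on (\<lambda>p. card (I \<inter> {1..<p})) I"
    by (rule inj_onI) (metis less less_irrefl linorder_neqE_nat)
  have sub: "(\<lambda>p. card (I \<inter> {1..<p})) ` I \<subseteq> {..<card I}"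
  proof (rule image_subsetI)
    fix p assume "p \<in> I"
    then have "I \<inter> {1..<p} \<subset> I" by auto
    then show "card (I \<inter> {1..<p}) \<in> {..<card I}"
      using psubset_card_mono[OF assms(1)] by simp
  qed
  have "(\<lambda>p. card (I \<inter> {1..<p})) ` I = {..<card I}"
    by (rule card_subset_eq) (use sub inj in \<open>auto simp: card_image\<close>)
  with inj show ?thesis by (simp add: bij_betw_def)
qed

context
  fixes I :: "nat set" and m n :: nat
  assumes I: "I \<subseteq> {1..m + n}" "card I = m"
begin

private lemma finite_I: "finite I"
  using I finite_subset by blast

private lemma card_J: "card ({1..m + n} - I) = n"
  using I finite_I by (simp add: card_Diff_subset)

private lemma rank_I: "bij_betw (\<lambda>p. card (I \<inter> {1..<p})) I {..<m}"
proof -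
  have "0 \<notin> I" using I(1) by auto
  then show ?thesis using bij_betw_rank[OF finite_I] I(2) by simp
qed

private lemma rank_J: "bij_betw (\<lambda>p. card ({1..<p} - I)) ({1..m + n} - I) {..<n}"
proof -
  have "bij_betw (\<lambda>p. card (({1..m + n} - I) \<inter> {1..<p})) ({1..m + n} - I) {..<n}"
    using bij_betw_rank[of "{1..m + n} - I"] card_J by auto
  moreover have "({1..m + n} - I) \<inter> {1..<p} = {1..<p} - I" if "p \<in> {1..m + n} - I" for p
    using that by auto
  ultimately show ?thesis by (subst bij_betw_cong[where g = "\<lambda>p. card (({1..m + n} - I) \<inter> {1..<p})"]) auto
qed

lemma merge_rank_less:
  "p \<in> I \<Longrightarrow> card (I \<inter> {1..<p}) < m"
  "p \<in> {1..m + n} \<Longrightarrow> p \<notin> I \<Longrightarrow> card ({1..<p} - I) < n"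
  using bij_betwE[OF rank_I] bij_betwE[OF rank_J] by auto

lemma set_merge:
  assumes "length as = m" "length bs = n"
  shows "set (merge I as bs) = set as \<union> set bs"
proof -
  have "set (merge I as bs) =
    (\<lambda>p. if p \<in> I then as ! card (I \<inter> {1..<p}) else bs ! card ({1..<p} - I)) ` {1..m + n}"
    using assms by (simp add: merge_def atLeastLessThanSuc_atLeastAtMost del: upt_Suc)
  also have "{1..m + n} = I \<union> ({1..m + n} - I)" using I by auto
  finally have "set (merge I as bs) = (!) as ` (\<lambda>p. card (I \<inter> {1..<p})) ` I \<union>
      (!) bs ` (\<lambda>p. card ({1..<p} - I)) ` ({1..m + n} - I)"
    by (auto simp: image_Un image_image)
  then show ?thesis
    unfolding bij_betw_imp_surj_on[OF rank_I] bij_betw_imp_surj_on[OF rank_J] using assms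
    by (simp add: lessThan_atLeast0 nth_image)
qed

lemma map_merge:
  assumes "length as = m" "length bs = n"
  shows "map f (merge I as bs) = merge I (map f as) (map f bs)"
  using assms merge_rank_less by (auto simp: merge_def simp del: upt_Suc)

lemma zip_merge:
  assumes "length as = m" "length bs = n" "length as' = m" "length bs' = n"
  shows "zip (merge I as bs) (merge I as' bs') = merge I (zip as as') (zip bs bs')"
  using assms merge_rank_less
  by (auto simp: merge_def list_eq_iff_nth_eq simp del: upt_Suc)

lemma list_all2_merge:
  assumes "length as = m" "length bs = n" "length as' = m" "length bs' = n"
  shows "list_all2 P (merge I as bs) (merge I as' bs') \<longleftrightarrow> list_all2 P as as' \<and> list_all2 P bs bs'"
proof -
  have "set (merge I (zip as as') (zip bs bs')) = set (zip as as') \<union> set (zip bs bs')"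
    using assms by (intro set_merge) auto
  then show ?thesis
    using assms by (auto simp: list_all2_iff zip_merge) (auto simp: merge_def)
qed

lemma merge_split:
  assumes "length xs = m + n"
  obtains as bs where "xs = merge I as bs" "length as = m" "length bs = n"
proof -
  let ?r = "\<lambda>p. card (I \<inter> {1..<p})" and ?r' = "\<lambda>p. card ({1..<p} - I)"
  \<comment> \<open>Entry \<open>j\<close> of \<open>as\<close> is read at the position of rank
    \<open>j\<close> in \<open>I\<close>; positions start at 1 and list indices at 0.\<close>
  define as where "as = map (\<lambda>j. xs ! (inv_into I ?r j - 1)) [0..<m]"
  define bs where "bs = map (\<lambda>j. xs ! (inv_into ({1..m + n} - I) ?r' j - 1)) [0..<n]"
  have [simp]: "length as = m" "length bs = n" by (simp_all add: as_def bs_def)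
  have "merge I as bs ! k = xs ! k" if k: "k < m + n" for k
  proof (cases "Suc k \<in> I")
    case True
    then have "as ! ?r (Suc k) = xs ! k"
      using merge_rank_less(1)[OF True] bij_betw_inv_into_left[OF rank_I True] by (simp add: as_def)
    with True k show ?thesis by (simp add: merge_def del: upt_Suc)
  next
    case False
    then have *: "Suc k \<in> {1..m + n} - I" using k by auto
    then have "bs ! ?r' (Suc k) = xs ! k"
      using merge_rank_less(2)[of "Suc k"] bij_betw_inv_into_left[OF rank_J *] by (simp add: bs_def)
    with False k show ?thesis by (simp add: merge_def del: upt_Suc)
  qed
  then have "xs = merge I as bs"
    using assms by (auto simp: list_eq_iff_nth_eq) (auto simp: merge_def)
  then show ?thesis using that by simp
qed

end

lemma length_merge [simp]: "length (merge I as bs) = length as + length bs"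
  by (simp add: merge_def del: upt_Suc)

lemma merge_nth:
  assumes "k < length as + length bs"
  shows "merge I as bs ! k =
    (if Suc k \<in> I then as ! card (I \<inter> {1..<Suc k}) else bs ! card ({1..<Suc k} - I))"
  using assms by (simp add: merge_def del: upt_Suc)

text \<open>In \<open>tup_colored\<close> it cuts a tuple of leaves into those below the left child
  and the others. Either part may be empty.\<close>

lemma merge_partition:
  fixes Q :: "'a \<Rightarrow> bool" and xs :: "'a list"
  defines "I \<equiv> {p \<in> {1..length xs}. Q (xs ! (p - 1))}"
  obtains as bs where "xs = merge I as bs" "I \<subseteq> {1..length as + length bs}" "card I = length as"
    "\<forall>x\<in>set as. Q x" "\<forall>x\<in>set bs. \<not> Q x"
proof -
  define m n where "m = card I" and "n = length xs - card I"
  have "I \<subseteq> {1..length xs}" by (auto simp: I_def)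
  from card_mono[OF _ this] have "card I \<le> length xs" by simp
  then have len: "length xs = m + n" by (simp add: m_def n_def)
  then have I: "I \<subseteq> {1..m + n}" "card I = m" by (auto simp: I_def m_def n_def)
  from merge_split[OF I len] obtain as bs where xs: "xs = merge I as bs" "length as = m" "length bs = n" .
  \<comment> \<open>The merge of two constant lists is the characteristic list of \<open>I\<close>,
    so comparing with it entry by entry settles both parts at once.\<close>
  have "list_all2 (\<lambda>x b. Q x = b) xs (merge I (replicate m True) (replicate n False))"
    unfolding list_all2_conv_all_nth
  proof (intro conjI allI impI)
    fix k assume "k < length xs"
    moreover have "Suc k \<in> I \<longleftrightarrow> Q (xs ! k)" using \<open>k < length xs\<close> by (simp add: I_def)
    ultimately show "Q (xs ! k) = merge I (replicate m True) (replicate n False) ! k"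
      using merge_rank_less[OF I, of "Suc k"] len by (simp add: merge_nth)
  qed (simp add: len)
  then have "list_all2 (\<lambda>x b. Q x = b) as (replicate m True)" "list_all2 (\<lambda>x b. Q x = b) bs (replicate n False)"
    using list_all2_merge[OF I xs(2,3), of "replicate m True" "replicate n False"] xs(1) by auto
  then have "\<forall>x\<in>set as. Q x" "\<forall>x\<in>set bs. \<not> Q x"
    by (auto simp: list_all2_conv_all_nth in_set_conv_nth)
  then show ?thesis using that xs I by blast
qed

subsection \<open>Recognizable predicates of valuations\<close>

text \<open>An antichain of nodes is all that the calculus of types sees of a tree; instructions
  enter only through atoms. Leaves may lie at unbounded depth, and branches may avoid them
  altogether.\<close>

locale leaf_tree =
  fixes Lv :: "node set"
  assumes antichain: "l \<in> Lv \<Longrightarrow> l @ s \<in> Lv \<Longrightarrow> s = []"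
begin

definition below :: "node \<Rightarrow> node set" where
  "below s = {l \<in> Lv. \<exists>s'. l = s @ s'}"

lemma below_Nil [simp]: "below [] = Lv"
  by (simp add: below_def)

lemma below_leaf: "s \<in> Lv \<Longrightarrow> below s = {s}"
  using antichain by (auto simp: below_def)

lemma below_leaf_child: "s \<in> Lv \<Longrightarrow> below (s @ [i]) = {}"
  using antichain by (fastforce simp: below_def)

lemma below_subset: "below (s @ s') \<subseteq> below s" "below s \<subseteq> Lv"
  by (auto simp: below_def)

lemma below_nonleaf:
  assumes "s \<notin> Lv"
  shows "below s = below (s @ [False]) \<union> below (s @ [True])"
proof -
  have "l \<in> below (s @ [False]) \<union> below (s @ [True])" if "l \<in> below s" for l
  proof -
    from that obtain s' where s': "l = s @ s'" "l \<in> Lv" by (auto simp: below_def)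
    with assms obtain b s'' where "s' = b # s''" by (cases s') auto
    with s' show ?thesis by (cases b) (auto simp: below_def)
  qed
  then show ?thesis using below_subset(1) by blast
qed

lemma below_disjoint: "below (s @ [False]) \<inter> below (s @ [True]) = {}"
  by (auto simp: below_def)

text \<open>The range is bounded over all nodes at once, whereas the implied composition function
  may differ from node to node. The children of a leaf see no part of a valuation, hence the
  exception in the last clause; at a leaf only locality constrains the type.\<close>

definition compositional :: "(node \<Rightarrow> ('v \<Rightarrow> node set) \<Rightarrow> 'a) \<Rightarrow> bool" where
  "compositional \<rho> \<longleftrightarrow>
     finite {\<rho> s \<gamma> | s \<gamma>. True} \<and>
     (\<forall>s \<gamma> \<gamma>'. (\<forall>v. \<gamma> v \<inter> below s = \<gamma>' v \<inter> below s) \<longrightarrow> \<rho> s \<gamma> = \<rho> s \<gamma>') \<and>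
     (\<forall>s \<gamma> \<gamma>'. s \<notin> Lv \<longrightarrow> \<rho> (s @ [False]) \<gamma> = \<rho> (s @ [False]) \<gamma>' \<longrightarrow>
        \<rho> (s @ [True]) \<gamma> = \<rho> (s @ [True]) \<gamma>' \<longrightarrow> \<rho> s \<gamma> = \<rho> s \<gamma>')"

definition decides :: "(node \<Rightarrow> ('v \<Rightarrow> node set) \<Rightarrow> 'a) \<Rightarrow> (('v \<Rightarrow> node set) \<Rightarrow> bool) \<Rightarrow> bool" where
  "decides \<rho> Q \<longleftrightarrow> (\<forall>\<gamma> \<gamma>'. \<rho> [] \<gamma> = \<rho> [] \<gamma>' \<longrightarrow> Q \<gamma> = Q \<gamma>')"

text \<open>Types are natural numbers because an existential quantifier cannot bind a HOL type;
  \<open>compositional_to_nat\<close> recodes any other finite range.\<close>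

definition recog :: "(('v \<Rightarrow> node set) \<Rightarrow> bool) \<Rightarrow> bool" where
  "recog Q \<longleftrightarrow> (\<exists>\<rho> :: _ \<Rightarrow> _ \<Rightarrow> nat. compositional \<rho> \<and> decides \<rho> Q)"

lemma decidesI: "(\<And>\<gamma> \<gamma>'. \<rho> [] \<gamma> = \<rho> [] \<gamma>' \<Longrightarrow> Q \<gamma> \<Longrightarrow> Q \<gamma>') \<Longrightarrow> decides \<rho> Q"
  unfolding decides_def by (metis (no_types))

lemma decidesD: "decides \<rho> Q \<Longrightarrow> \<rho> [] \<gamma> = \<rho> [] \<gamma>' \<Longrightarrow> Q \<gamma> \<longleftrightarrow> Q \<gamma>'"
  unfolding decides_def by blast

lemma compositionalI:
  assumes "\<And>s \<gamma>. \<rho> s \<gamma> \<in> F" "finite F"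
    and "\<And>s \<gamma> \<gamma>'. (\<And>v. \<gamma> v \<inter> below s = \<gamma>' v \<inter> below s) \<Longrightarrow> \<rho> s \<gamma> = \<rho> s \<gamma>'"
    and "\<And>s \<gamma> \<gamma>'. s \<notin> Lv \<Longrightarrow> \<rho> (s @ [False]) \<gamma> = \<rho> (s @ [False]) \<gamma>' \<Longrightarrow>
        \<rho> (s @ [True]) \<gamma> = \<rho> (s @ [True]) \<gamma>' \<Longrightarrow> \<rho> s \<gamma> = \<rho> s \<gamma>'"
  shows "compositional \<rho>"
  unfolding compositional_def
proof (intro conjI allI impI)
  show "finite {\<rho> s \<gamma> |s \<gamma>. True}" by (rule finite_subset[OF _ assms(2)]) (use assms(1) in auto)
qed (use assms(3,4) in blast)+

lemma compositional_local:
  "compositional \<rho> \<Longrightarrow> (\<And>v. \<gamma> v \<inter> below s = \<gamma>' v \<inter> below s) \<Longrightarrow> \<rho> s \<gamma> = \<rho> s \<gamma>'"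
  by (simp add: compositional_def)

lemma compositional_step:
  "compositional \<rho> \<Longrightarrow> s \<notin> Lv \<Longrightarrow> \<rho> (s @ [False]) \<gamma> = \<rho> (s @ [False]) \<gamma>' \<Longrightarrow>
    \<rho> (s @ [True]) \<gamma> = \<rho> (s @ [True]) \<gamma>' \<Longrightarrow> \<rho> s \<gamma> = \<rho> s \<gamma>'"
  unfolding compositional_def by blast

lemma compositional_to_nat:
  assumes "compositional \<rho>"
  obtains \<rho>' :: "node \<Rightarrow> ('v \<Rightarrow> node set) \<Rightarrow> nat"
  where "compositional \<rho>'" "\<And>Q. decides \<rho> Q \<Longrightarrow> decides \<rho>' Q"
proof -
  let ?F = "{\<rho> s \<gamma> | s \<gamma>. True}"
  have fin: "finite ?F" using assms by (simp add: compositional_def)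
  then obtain enc :: "_ \<Rightarrow> nat" where enc: "inj_on enc ?F"
    using finite_imp_inj_to_nat_seg[OF fin] by auto
  have eq: "enc (\<rho> s \<gamma>) = enc (\<rho> s' \<gamma>') \<longleftrightarrow> \<rho> s \<gamma> = \<rho> s' \<gamma>'" for s \<gamma> s' \<gamma>'
    using inj_on_eq_iff[OF enc, of "\<rho> s \<gamma>" "\<rho> s' \<gamma>'"] by blast
  have "compositional (\<lambda>s \<gamma>. enc (\<rho> s \<gamma>))"
  proof (rule compositionalI[where F = "enc ` ?F"])
    show "finite (enc ` ?F)" using fin by simp
    show "enc (\<rho> s \<gamma>) \<in> enc ` ?F" for s \<gamma> by blast
    show "enc (\<rho> s \<gamma>) = enc (\<rho> s \<gamma>')" if "\<And>v. \<gamma> v \<inter> below s = \<gamma>' v \<inter> below s" for s \<gamma> \<gamma>'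
      using compositional_local[OF assms that] by simp
    show "enc (\<rho> s \<gamma>) = enc (\<rho> s \<gamma>')"
      if "s \<notin> Lv" "enc (\<rho> (s @ [False]) \<gamma>) = enc (\<rho> (s @ [False]) \<gamma>')"
        "enc (\<rho> (s @ [True]) \<gamma>) = enc (\<rho> (s @ [True]) \<gamma>')" for s \<gamma> \<gamma>'
      using compositional_step[OF assms that(1)] that(2,3) unfolding eq by blast
  qed
  moreover have "decides (\<lambda>s \<gamma>. enc (\<rho> s \<gamma>)) Q" if "decides \<rho> Q" for Q
    by (rule decidesI) (use decidesD[OF that] eq in blast)
  ultimately show ?thesis using that by blast
qed

lemma recogI: "compositional \<rho> \<Longrightarrow> decides \<rho> Q \<Longrightarrow> recog Q"
  unfolding recog_def using compositional_to_nat by metis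

lemma compositional_Pair:
  assumes "compositional \<rho>" "compositional \<rho>'"
  shows "compositional (\<lambda>s \<gamma>. (\<rho> s \<gamma>, \<rho>' s \<gamma>))"
proof (rule compositionalI[where F = "{\<rho> s \<gamma> | s \<gamma>. True} \<times> {\<rho>' s \<gamma> | s \<gamma>. True}"])
  show "finite ({\<rho> s \<gamma> | s \<gamma>. True} \<times> {\<rho>' s \<gamma> | s \<gamma>. True})"
    using assms by (simp add: compositional_def)
  show "(\<rho> s \<gamma>, \<rho>' s \<gamma>) = (\<rho> s \<gamma>', \<rho>' s \<gamma>')"
    if "\<And>v. \<gamma> v \<inter> below s = \<gamma>' v \<inter> below s" for s \<gamma> \<gamma>'
    using compositional_local[OF assms(1) that] compositional_local[OF assms(2) that] by simp
  show "(\<rho> s \<gamma>, \<rho>' s \<gamma>) = (\<rho> s \<gamma>', \<rho>' s \<gamma>')"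
    if "s \<notin> Lv"
      "(\<rho> (s @ [False]) \<gamma>, \<rho>' (s @ [False]) \<gamma>) = (\<rho> (s @ [False]) \<gamma>', \<rho>' (s @ [False]) \<gamma>')"
      "(\<rho> (s @ [True]) \<gamma>, \<rho>' (s @ [True]) \<gamma>) = (\<rho> (s @ [True]) \<gamma>', \<rho>' (s @ [True]) \<gamma>')"
    for s \<gamma> \<gamma>'
    using that compositional_step[OF assms(1), of s \<gamma> \<gamma>'] compositional_step[OF assms(2), of s \<gamma> \<gamma>']
    by simp
qed blast

text \<open>All relations of the target signature have to be decided by the same colors, hence by
  one common \<rho>.\<close>

lemma recog_family:
  fixes Q :: "'i \<Rightarrow> ('v \<Rightarrow> node set) \<Rightarrow> bool"
  assumes "finite X" "\<And>i. i \<in> X \<Longrightarrow> recog (Q i)"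
  shows "\<exists>\<rho> :: node \<Rightarrow> ('v \<Rightarrow> node set) \<Rightarrow> nat. compositional \<rho> \<and> (\<forall>i\<in>X. decides \<rho> (Q i))"
  using assms
proof (induction X)
  case empty
  have "compositional (\<lambda>(s :: node) (\<gamma> :: 'v \<Rightarrow> node set). 0 :: nat)"
    by (rule compositionalI[where F = "{0}"]) auto
  then show ?case by auto
next
  case (insert i X)
  then obtain \<rho> \<rho>' :: "node \<Rightarrow> ('v \<Rightarrow> node set) \<Rightarrow> nat"
    where \<rho>: "compositional \<rho>" "\<forall>i\<in>X. decides \<rho> (Q i)" "compositional \<rho>'" "decides \<rho>' (Q i)"
    unfolding recog_def by (metis insertI1 insertI2)
  have "decides (\<lambda>s \<gamma>. (\<rho> s \<gamma>, \<rho>' s \<gamma>)) (Q j)" if "j \<in> insert i X" for j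
    by (rule decidesI) (use that \<rho>(2,4) in \<open>auto dest: decidesD\<close>)
  moreover obtain \<rho>'' :: "node \<Rightarrow> ('v \<Rightarrow> node set) \<Rightarrow> nat" where "compositional \<rho>''"
    "\<And>Q. decides (\<lambda>s \<gamma>. (\<rho> s \<gamma>, \<rho>' s \<gamma>)) Q \<Longrightarrow> decides \<rho>'' Q"
    using compositional_to_nat[OF compositional_Pair[OF \<rho>(1,3)]] by blast
  ultimately show ?case by blast
qed

section \<open>Closure of recognizable predicates under the logical operations\<close>

lemma recog_const: "recog (\<lambda>\<gamma>. b)"
  by (rule recogI[where \<rho> = "\<lambda>_ _. ()"]) (auto simp: compositional_def decides_def)

text \<open>The same types serve for the complement, because \<open>decides\<close> only asks that
  equal root types give equal truth values.\<close>

lemma recog_not: "recog Q \<Longrightarrow> recog (\<lambda>\<gamma>. \<not> Q \<gamma>)"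
  unfolding recog_def decides_def by metis

lemma recog_conj:
  assumes "recog Q" "recog Q'"
  shows "recog (\<lambda>\<gamma>. Q \<gamma> \<and> Q' \<gamma>)"
proof -
  from assms obtain \<rho> \<rho>' :: "node \<Rightarrow> ('a \<Rightarrow> node set) \<Rightarrow> nat"
    where \<rho>: "compositional \<rho>" "decides \<rho> Q" "compositional \<rho>'" "decides \<rho>' Q'"
    by (auto simp: recog_def)
  show ?thesis
    by (rule recogI[OF compositional_Pair[OF \<rho>(1,3)]], rule decidesI)
      (use decidesD[OF \<rho>(2)] decidesD[OF \<rho>(4)] in blast)
qed

lemma recog_rename:
  assumes "recog Q"
  shows "recog (\<lambda>\<gamma>. Q (\<lambda>v. \<gamma> (\<sigma> v)))"
proof -
  from assms obtain \<rho> :: "node \<Rightarrow> ('a \<Rightarrow> node set) \<Rightarrow> nat"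
    where \<rho>: "compositional \<rho>" "decides \<rho> Q" by (auto simp: recog_def)
  have "compositional (\<lambda>s (\<gamma> :: 'b \<Rightarrow> node set). \<rho> s (\<lambda>v. \<gamma> (\<sigma> v)))"
  proof (rule compositionalI[where F = "{\<rho> s \<gamma> | s \<gamma>. True}"])
    show "finite {\<rho> s \<gamma> | s \<gamma>. True}" using \<rho>(1) by (simp add: compositional_def)
    show "\<rho> s (\<lambda>v. \<gamma> (\<sigma> v)) \<in> {\<rho> s \<gamma> | s \<gamma>. True}" for s and \<gamma> :: "'b \<Rightarrow> node set" by blast
    show "\<rho> s (\<lambda>v. \<gamma> (\<sigma> v)) = \<rho> s (\<lambda>v. \<gamma>' (\<sigma> v))"
      if "\<And>v. \<gamma> v \<inter> below s = \<gamma>' v \<inter> below s" for s \<gamma> \<gamma>'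
      using that by (intro compositional_local[OF \<rho>(1)])
  qed (rule compositional_step[OF \<rho>(1)])
  then show ?thesis
    by (rule recogI) (rule decidesI, use decidesD[OF \<rho>(2)] in blast)
qed

lemma recog_exists_set:
  assumes "recog Q"
  shows "recog (\<lambda>\<gamma>. \<exists>S\<subseteq>Lv. Q (\<gamma>(v := S)))"
proof -
  from assms obtain \<rho> :: "node \<Rightarrow> ('a \<Rightarrow> node set) \<Rightarrow> nat"
    where \<rho>: "compositional \<rho>" "decides \<rho> Q" by (auto simp: recog_def)
  define \<rho>' where "\<rho>' s \<gamma> = (\<lambda>S. \<rho> s (\<gamma>(v := S))) ` UNIV" for s \<gamma>
  have step: "\<rho>' s \<gamma> \<subseteq> \<rho>' s \<gamma>'"
    if "s \<notin> Lv" "\<rho>' (s @ [False]) \<gamma> = \<rho>' (s @ [False]) \<gamma>'" "\<rho>' (s @ [True]) \<gamma> = \<rho>' (s @ [True]) \<gamma>'"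
    for s \<gamma> \<gamma>'
  proof
    fix a assume "a \<in> \<rho>' s \<gamma>"
    then obtain S where a: "a = \<rho> s (\<gamma>(v := S))" by (auto simp: \<rho>'_def)
    have "\<rho> (s @ [i]) (\<gamma>(v := S)) \<in> \<rho>' (s @ [i]) \<gamma>'" for i
      using that(2,3) by (cases i) (auto simp: \<rho>'_def)
    then have "\<exists>S'. \<rho> (s @ [i]) (\<gamma>(v := S)) = \<rho> (s @ [i]) (\<gamma>'(v := S'))" for i
      by (auto simp: \<rho>'_def)
    then obtain S' where S': "\<rho> (s @ [i]) (\<gamma>(v := S)) = \<rho> (s @ [i]) (\<gamma>'(v := S' i))" for i by metis
    \<comment> \<open>The witnesses for the two children may disagree outside their own subtrees; as
      the subtrees are disjoint, the relevant parts glue to one set.\<close>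
    let ?S = "\<Union>i. S' i \<inter> below (s @ [i])"
    have "\<rho> (s @ [i]) (\<gamma>'(v := S' i)) = \<rho> (s @ [i]) (\<gamma>'(v := ?S))" for i
      using below_disjoint by (intro compositional_local[OF \<rho>(1)]) (cases i; auto simp: UNIV_bool)
    then have "\<rho> s (\<gamma>(v := S)) = \<rho> s (\<gamma>'(v := ?S))"
      by (intro compositional_step[OF \<rho>(1) that(1)]) (simp_all add: S')
    then show "a \<in> \<rho>' s \<gamma>'" by (auto simp: \<rho>'_def a)
  qed
  have "compositional \<rho>'"
  proof (rule compositionalI[where F = "Pow {\<rho> s \<gamma> | s \<gamma>. True}"])
    show "finite (Pow {\<rho> s \<gamma> | s \<gamma>. True})" using \<rho>(1) by (simp add: compositional_def)
    show "\<rho>' s \<gamma> = \<rho>' s \<gamma>'" if "\<And>u. \<gamma> u \<inter> below s = \<gamma>' u \<inter> below s" for s \<gamma> \<gamma>'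
      unfolding \<rho>'_def using that by (intro image_cong refl compositional_local[OF \<rho>(1)]) auto
    show "\<rho>' s \<gamma> = \<rho>' s \<gamma>'"
      if "s \<notin> Lv" "\<rho>' (s @ [False]) \<gamma> = \<rho>' (s @ [False]) \<gamma>'" "\<rho>' (s @ [True]) \<gamma> = \<rho>' (s @ [True]) \<gamma>'"
      for s \<gamma> \<gamma>'
      by (rule equalityI; rule step) (simp_all only: that not_False_eq_True)
  qed (auto simp: \<rho>'_def)
  moreover have "decides \<rho>' (\<lambda>\<gamma>. \<exists>S\<subseteq>Lv. Q (\<gamma>(v := S)))"
  proof -
    have "\<exists>S\<subseteq>Lv. Q (\<gamma>'(v := S))" if eq: "\<rho>' [] \<gamma> = \<rho>' [] \<gamma>'" and S: "Q (\<gamma>(v := S))" for \<gamma> \<gamma>' S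
    proof -
      have "\<rho> [] (\<gamma>(v := S)) \<in> \<rho>' [] \<gamma>'" using eq by (auto simp: \<rho>'_def)
      then obtain S' where "\<rho> [] (\<gamma>(v := S)) = \<rho> [] (\<gamma>'(v := S'))" by (auto simp: \<rho>'_def)
      \<comment> \<open>In \<open>\<rho>'\<close> the set ranges over \<open>UNIV\<close>; locality
        at the root, where \<open>below []\<close> is \<open>Lv\<close>, cuts it down to
        leaves.\<close>
      also have "\<dots> = \<rho> [] (\<gamma>'(v := S' \<inter> Lv))"
        by (intro compositional_local[OF \<rho>(1)]) auto
      finally show ?thesis using S decidesD[OF \<rho>(2)] by blast
    qed
    then show ?thesis by (intro decidesI) blast
  qed
  ultimately show ?thesis by (rule recogI)
qed

text \<open>A leaf lies below at most one child, and the other child sees \<open>v\<close> valued by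
  the empty set. Hence the type is a pair: the first component is the type without the leaf, the
  second collects the types with the leaf somewhere inside.\<close>

lemma recog_exists:
  assumes "recog Q"
  shows "recog (\<lambda>\<gamma>. \<exists>l\<in>Lv. Q (\<gamma>(v := {l})))"
proof -
  from assms obtain \<rho> :: "node \<Rightarrow> ('a \<Rightarrow> node set) \<Rightarrow> nat"
    where \<rho>: "compositional \<rho>" "decides \<rho> Q" by (auto simp: recog_def)
  define \<rho>' where "\<rho>' s \<gamma> = (\<rho> s (\<gamma>(v := {})), (\<lambda>l. \<rho> s (\<gamma>(v := {l}))) ` below s)" for s \<gamma>
  have out: "\<rho> s (\<gamma>(v := {l})) = \<rho> s (\<gamma>(v := {}))" if "l \<notin> below s" for s \<gamma> l
    using that by (intro compositional_local[OF \<rho>(1)]) auto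
  have step: "snd (\<rho>' s \<gamma>) \<subseteq> snd (\<rho>' s \<gamma>')"
    if "s \<notin> Lv" "\<rho>' (s @ [False]) \<gamma> = \<rho>' (s @ [False]) \<gamma>'" "\<rho>' (s @ [True]) \<gamma> = \<rho>' (s @ [True]) \<gamma>'"
    for s \<gamma> \<gamma>'
  proof
    fix a assume "a \<in> snd (\<rho>' s \<gamma>)"
    then obtain l where l: "l \<in> below s" "a = \<rho> s (\<gamma>(v := {l}))" by (auto simp: \<rho>'_def)
    then obtain i where i: "l \<in> below (s @ [i])" using below_nonleaf[OF \<open>s \<notin> Lv\<close>] by auto
    have eq: "\<rho>' (s @ [j]) \<gamma> = \<rho>' (s @ [j]) \<gamma>'" for j using that(2,3) by (cases j) auto
    from i have "\<rho> (s @ [i]) (\<gamma>(v := {l})) \<in> snd (\<rho>' (s @ [i]) \<gamma>)" by (simp add: \<rho>'_def)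
    then obtain l' where l': "l' \<in> below (s @ [i])"
      "\<rho> (s @ [i]) (\<gamma>(v := {l})) = \<rho> (s @ [i]) (\<gamma>'(v := {l'}))"
      unfolding eq by (auto simp: \<rho>'_def)
    have "\<rho> (s @ [j]) (\<gamma>(v := {l})) = \<rho> (s @ [j]) (\<gamma>'(v := {l'}))" for j
    proof (cases "j = i")
      case False
      then have "l \<notin> below (s @ [j])" "l' \<notin> below (s @ [j])"
        using i l'(1) below_disjoint[of s] by (cases i; cases j; auto)+
      then show ?thesis using eq[of j] by (simp add: out \<rho>'_def)
    qed (use l' in simp)
    then have "a = \<rho> s (\<gamma>'(v := {l'}))"
      unfolding l(2) by (intro compositional_step[OF \<rho>(1) that(1)]) auto
    then show "a \<in> snd (\<rho>' s \<gamma>')" using l'(1) below_subset(1) by (auto simp: \<rho>'_def)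
  qed
  have "compositional \<rho>'"
  proof (rule compositionalI[where F = "{\<rho> s \<gamma> | s \<gamma>. True} \<times> Pow {\<rho> s \<gamma> | s \<gamma>. True}"])
    show "finite ({\<rho> s \<gamma> | s \<gamma>. True} \<times> Pow {\<rho> s \<gamma> | s \<gamma>. True})"
      using \<rho>(1) by (simp add: compositional_def)
    show "\<rho>' s \<gamma> = \<rho>' s \<gamma>'" if "\<And>u. \<gamma> u \<inter> below s = \<gamma>' u \<inter> below s" for s \<gamma> \<gamma>'
      unfolding \<rho>'_def using that
      by (intro arg_cong2[where f = Pair] image_cong refl compositional_local[OF \<rho>(1)]) auto
    show "\<rho>' s \<gamma> = \<rho>' s \<gamma>'"
      if "s \<notin> Lv" "\<rho>' (s @ [False]) \<gamma> = \<rho>' (s @ [False]) \<gamma>'" "\<rho>' (s @ [True]) \<gamma> = \<rho>' (s @ [True]) \<gamma>'"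
      for s \<gamma> \<gamma>'
    proof (rule prod_eqI)
      show "snd (\<rho>' s \<gamma>) = snd (\<rho>' s \<gamma>')"
        by (rule equalityI; rule step) (simp_all only: that not_False_eq_True)
      show "fst (\<rho>' s \<gamma>) = fst (\<rho>' s \<gamma>')"
        using that by (auto simp: \<rho>'_def intro: compositional_step[OF \<rho>(1)])
    qed
  qed (auto simp: \<rho>'_def)
  moreover have "decides \<rho>' (\<lambda>\<gamma>. \<exists>l\<in>Lv. Q (\<gamma>(v := {l})))"
  proof -
    have "\<exists>l\<in>Lv. Q (\<gamma>'(v := {l}))"
      if eq: "\<rho>' [] \<gamma> = \<rho>' [] \<gamma>'" and l: "l \<in> Lv" "Q (\<gamma>(v := {l}))" for \<gamma> \<gamma>' l
    proof -
      have "\<rho> [] (\<gamma>(v := {l})) \<in> snd (\<rho>' [] \<gamma>')" using eq l(1) by (auto simp: \<rho>'_def)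
      then obtain l' where "l' \<in> Lv" "\<rho> [] (\<gamma>(v := {l})) = \<rho> [] (\<gamma>'(v := {l'}))"
        by (auto simp: \<rho>'_def)
      then show ?thesis using l(2) decidesD[OF \<rho>(2)] by blast
    qed
    then show ?thesis by (intro decidesI) blast
  qed
  ultimately show ?thesis by (rule recogI)
qed

text \<open>Serves both equality and membership, as a term is valued by a set with at most one
  leaf.\<close>

lemma recog_meet: "recog (\<lambda>\<gamma>. \<gamma> u \<inter> \<gamma> v \<inter> Lv \<noteq> {})"
proof (rule recogI)
  show "compositional (\<lambda>s \<gamma>. \<gamma> u \<inter> \<gamma> v \<inter> below s \<noteq> {})"
  proof (rule compositionalI[where F = UNIV])
    fix s and \<gamma> \<gamma>' :: "'a \<Rightarrow> node set"
    assume "\<And>v. \<gamma> v \<inter> below s = \<gamma>' v \<inter> below s"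
    then show "(\<gamma> u \<inter> \<gamma> v \<inter> below s \<noteq> {}) = (\<gamma>' u \<inter> \<gamma>' v \<inter> below s \<noteq> {})" by blast
  next
    fix s and \<gamma> \<gamma>' :: "'a \<Rightarrow> node set"
    assume "s \<notin> Lv" "(\<gamma> u \<inter> \<gamma> v \<inter> below (s @ [False]) \<noteq> {}) = (\<gamma>' u \<inter> \<gamma>' v \<inter> below (s @ [False]) \<noteq> {})"
      "(\<gamma> u \<inter> \<gamma> v \<inter> below (s @ [True]) \<noteq> {}) = (\<gamma>' u \<inter> \<gamma>' v \<inter> below (s @ [True]) \<noteq> {})"
    then show "(\<gamma> u \<inter> \<gamma> v \<inter> below s \<noteq> {}) = (\<gamma>' u \<inter> \<gamma>' v \<inter> below s \<noteq> {})"
      unfolding below_nonleaf[OF \<open>s \<notin> Lv\<close>] Int_Un_distrib by simp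
  qed auto
qed (simp add: decides_def)

end

subsection \<open>Recognizability of MSO formulas over a represented instance\<close>

locale decorated_tree =
  fixes \<Sigma> :: "'r signature" and L :: "'l coloring" and C :: "'c set" and T :: "('l, 'r, 'c) tree"
  assumes coloring: "is_coloring \<Sigma> L" and wd: "well_decorated L C \<Sigma> T"
begin

section \<open>Leaves in place of entities\<close>

definition leaves :: "node set" where
  "leaves = {l. pseudoleaf T l}"

lemma mem_leaves_iff [simp]: "l \<in> leaves \<longleftrightarrow> pseudoleaf T l"
  by (simp add: leaves_def)

sublocale leaf_tree leaves
proof
  fix l s assume "l \<in> leaves" "l @ s \<in> leaves"
  moreover have "T (l @ s) = {}" if "pseudoleaf T l" "s \<noteq> []"
    using that wd unfolding well_decorated_def by blast
  ultimately show "s = []" by (auto simp: pseudoleaf_def)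
qed

lemma is_instructionD: "Instr x \<in> T s \<Longrightarrow> is_instruction \<Sigma> L x"
  using wd unfolding well_decorated_def by auto

lemma AddD:
  assumes "Instr (Add \<kappa> \<mu> I \<nu>) \<in> T s"
  shows "I \<subseteq> {1..color_arity L \<kappa> + color_arity L \<mu>}" "card I = color_arity L \<kappa>"
    "color_arity L \<nu> = color_arity L \<kappa> + color_arity L \<mu>" "\<nu> \<in> colors L"
  using is_instructionD[OF assms] by auto

lemma RAddD:
  assumes "Instr (RAdd \<kappa> \<mu> I R) \<in> T s"
  shows "I \<subseteq> {1..color_arity L \<kappa> + color_arity L \<mu>}" "card I = color_arity L \<kappa>"
  using is_instructionD[OF assms] by auto

definition ent :: "node \<Rightarrow> ('c, node) trm" where
  "ent l = (if Star \<in> T l then Null l else Const (THE c. DConst c \<in> T l))"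

lemma ent_Star: "Star \<in> T l \<Longrightarrow> ent l = Null l"
  by (simp add: ent_def)

lemma leaf_decor:
  assumes "pseudoleaf T l"
  shows "\<exists>d. T l = {d}"
  using assms wd unfolding well_decorated_def by blast

lemma ent_DConst:
  assumes "DConst c \<in> T l"
  shows "ent l = Const c"
proof -
  have "T l = {DConst c}" using leaf_decor[of l] assms by (force simp: pseudoleaf_def)
  then show ?thesis by (auto simp: ent_def)
qed

lemma const_unique: "DConst c \<in> T s \<Longrightarrow> DConst c \<in> T s' \<Longrightarrow> s = s'"
  using wd unfolding well_decorated_def by blast

text \<open>A constant decorates at most one node and a null is its own node, so leaves and entities
  are interchangeable.\<close>

lemma inj_on_ent: "inj_on ent leaves"
proof (rule inj_onI)
  fix l l' assume "l \<in> leaves" "l' \<in> leaves" "ent l = ent l'"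
  then show "l = l'"
    using const_unique by (auto simp: pseudoleaf_def ent_Star ent_DConst)
qed

lemma map_ent_eq:
  assumes "map ent ls = map ent ls'" "set ls \<subseteq> leaves" "set ls' \<subseteq> leaves"
  shows "ls = ls'"
  using assms inj_on_subset[OF inj_on_ent] by (metis inj_on_map_eq_map Un_least)

lemma colored_entities:
  assumes "colored \<Sigma> L T s \<kappa> e"
  shows "\<kappa> \<in> colors L \<and> length e = color_arity L \<kappa> \<and> (\<exists>ls. set ls \<subseteq> below s \<and> e = map ent ls)"
  using assms
proof induction
  case (const c s i)
  then have "set (replicate i s) \<subseteq> below s" "replicate i (Const c) = map ent (replicate i s)"
    using below_leaf[of s] by (auto simp: ent_DConst pseudoleaf_def)
  moreover have "leaf_color L i \<in> colors L" "color_arity L (leaf_color L i) = i"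
    using const(2) coloring unfolding is_coloring_def by auto
  ultimately show ?case by (metis length_replicate)
next
  case (star s i)
  then have "set (replicate i s) \<subseteq> below s" "replicate i (Null s) = map ent (replicate i s)"
    using below_leaf[of s] by (auto simp: ent_Star pseudoleaf_def)
  moreover have "leaf_color L i \<in> colors L" "color_arity L (leaf_color L i) = i"
    using star(2) coloring unfolding is_coloring_def by auto
  ultimately show ?case by (metis length_replicate)
next
  case (add s \<kappa> \<mu> I \<nu> as bs)
  then obtain as' bs' where *: "set as' \<subseteq> below (s @ [False])" "as = map ent as'"
    "set bs' \<subseteq> below (s @ [True])" "bs = map ent bs'" "length as' = color_arity L \<kappa>"
    "length bs' = color_arity L \<mu>"
    by auto
  note I = AddD[OF add.hyps(2)]
  have "set (merge I as' bs') \<subseteq> below s"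
    using set_merge[OF I(1,2) *(5,6)] * below_subset(1) by blast
  moreover have "merge I as bs = map ent (merge I as' bs')"
    using * by (simp add: map_merge[OF I(1,2) *(5,6)])
  ultimately show ?case using I * by (metis length_map length_merge)
next
  case (recol s i \<kappa> \<nu> e)
  then show ?case using is_instructionD[OF recol.hyps(2)] below_subset(1)[of s] by auto
next
  case (keep s i \<nu> e)
  then show ?case using below_subset(1)[of s] by blast
qed

text \<open>Valuations are sets of leaves, so colors are transported from tuples of entities to
  tuples of leaves; by \<open>map_ent_eq\<close> nothing is lost.\<close>

definition col :: "node \<Rightarrow> 'l \<Rightarrow> node list \<Rightarrow> bool" where
  "col s \<kappa> ls \<longleftrightarrow> set ls \<subseteq> below s \<and> colored \<Sigma> L T s \<kappa> (map ent ls)"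

lemma col_length: "col s \<kappa> ls \<Longrightarrow> length ls = color_arity L \<kappa>"
  and col_color: "col s \<kappa> ls \<Longrightarrow> \<kappa> \<in> colors L"
  unfolding col_def using colored_entities[of s \<kappa> "map ent ls"] by simp_all

lemma colored_imp_col:
  assumes "colored \<Sigma> L T s \<kappa> e"
  obtains ls where "col s \<kappa> ls" "e = map ent ls"
  using colored_entities[OF assms] assms that unfolding col_def by blast

lemma col_subset: "col s \<kappa> ls \<Longrightarrow> set ls \<subseteq> below s"
  by (simp add: col_def)

text \<open>The recursive equation of the colors, obtained from the inductive definition by case
  analysis. A tuple of entities stems from only one tuple of leaves, so the leaf tuples found at the
  children merge to the given one.\<close>

lemma col_nonleaf:
  assumes "s \<notin> leaves"
  shows "col s \<nu> ls \<longleftrightarrow>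
    (\<exists>\<kappa> \<mu> I as bs. Instr (Add \<kappa> \<mu> I \<nu>) \<in> T s \<and> ls = merge I as bs \<and>
       col (s @ [False]) \<kappa> as \<and> col (s @ [True]) \<mu> bs) \<or>
    (\<exists>i \<kappa>. Instr (Recol i \<kappa> \<nu>) \<in> T s \<and> col (s @ [i]) \<kappa> ls) \<or>
    (\<exists>i. (\<forall>\<kappa>. Instr (Recol i \<nu> \<kappa>) \<notin> T s) \<and> col (s @ [i]) \<nu> ls)" (is "_ \<longleftrightarrow> ?A \<or> ?R \<or> ?K")
proof
  assume l: "col s \<nu> ls"
  then have ls: "set ls \<subseteq> leaves" using below_subset(2) by (auto simp: col_def)
  have col_ls: "col s' \<kappa> ls" if "colored \<Sigma> L T s' \<kappa> (map ent ls)" for s' \<kappa>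
  proof -
    from that obtain ls' where "col s' \<kappa> ls'" "map ent ls = map ent ls'" using colored_imp_col by metis
    moreover then have "ls = ls'"
      using ls below_subset(2) col_subset by (intro map_ent_eq) blast+
    ultimately show ?thesis by simp
  qed
  from l have "colored \<Sigma> L T s \<nu> (map ent ls)" by (simp add: col_def)
  then show "?A \<or> ?R \<or> ?K"
  proof cases
    case (add \<kappa> \<mu> I as bs)
    obtain as' where as: "col (s @ [False]) \<kappa> as'" "as = map ent as'" using colored_imp_col add by metis
    obtain bs' where bs: "col (s @ [True]) \<mu> bs'" "bs = map ent bs'" using colored_imp_col add by metis
    note I = AddD[OF add(3)]
    have "map ent ls = map ent (merge I as' bs')"
      using add as bs by (simp add: map_merge[OF I(1,2) col_length[OF as(1)] col_length[OF bs(1)]])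
    moreover have "set (merge I as' bs') \<subseteq> leaves"
      using set_merge[OF I(1,2) col_length[OF as(1)] col_length[OF bs(1)]]
        col_subset[OF as(1)] col_subset[OF bs(1)] below_subset(2) by blast
    ultimately have "ls = merge I as' bs'" using ls by (intro map_ent_eq)
    then show ?thesis using add as bs by blast
  qed (use assms col_ls in \<open>auto simp: pseudoleaf_def\<close>)
next
  have nl: "\<not> pseudoleaf T s" using assms by simp
  assume "?A \<or> ?R \<or> ?K"
  then show "col s \<nu> ls"
  proof (elim disjE exE conjE)
    fix \<kappa> \<mu> I as bs
    assume *: "Instr (Add \<kappa> \<mu> I \<nu>) \<in> T s" "ls = merge I as bs" "col (s @ [False]) \<kappa> as" "col (s @ [True]) \<mu> bs"
    note I = AddD(1,2)[OF *(1)] col_length[OF *(3)] col_length[OF *(4)]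
    show ?thesis
      using * colored.add[OF nl *(1), of \<Sigma> L "map ent as" "map ent bs"] below_subset(1)
      unfolding col_def *(2) set_merge[OF I] map_merge[OF I] by blast
  next
    fix i \<kappa> assume "Instr (Recol i \<kappa> \<nu>) \<in> T s" "col (s @ [i]) \<kappa> ls"
    then show ?thesis using colored.recol[OF nl] below_subset(1) unfolding col_def by blast
  next
    fix i assume "\<forall>\<kappa>. Instr (Recol i \<nu> \<kappa>) \<notin> T s" "col (s @ [i]) \<nu> ls"
    then show ?thesis using colored.keep[OF nl] below_subset(1) unfolding col_def by blast
  qed
qed

lemma atoms_at_nonleaf:
  assumes "s \<notin> leaves" "set ls \<subseteq> leaves"
  shows "(R, map ent ls) \<in> atoms_at \<Sigma> L T s \<longleftrightarrow>
    (\<exists>\<kappa> \<mu> I as bs. Instr (RAdd \<kappa> \<mu> I R) \<in> T s \<and> ls = merge I as bs \<and>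
       col (s @ [False]) \<kappa> as \<and> col (s @ [True]) \<mu> bs) \<or>
    (\<exists>i \<kappa>. Instr (Mat i \<kappa> R) \<in> T s \<and> col (s @ [i]) \<kappa> ls)" (is "_ \<longleftrightarrow> ?A \<or> ?M")
proof
  have nl: "\<not> pseudoleaf T s" using assms by simp
  assume "(R, map ent ls) \<in> atoms_at \<Sigma> L T s"
  with nl consider \<kappa> \<mu> I as bs where "Instr (RAdd \<kappa> \<mu> I R) \<in> T s" "map ent ls = merge I as bs"
      "colored \<Sigma> L T (s @ [False]) \<kappa> as" "colored \<Sigma> L T (s @ [True]) \<mu> bs"
    | i \<kappa> where "Instr (Mat i \<kappa> R) \<in> T s" "colored \<Sigma> L T (s @ [i]) \<kappa> (map ent ls)"
    unfolding atoms_at_def by auto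
  then show "?A \<or> ?M"
  proof cases
    case (1 \<kappa> \<mu> I as bs)
    obtain as' where as: "col (s @ [False]) \<kappa> as'" "as = map ent as'" using colored_imp_col 1 by metis
    obtain bs' where bs: "col (s @ [True]) \<mu> bs'" "bs = map ent bs'" using colored_imp_col 1 by metis
    note I = RAddD[OF 1(1)] col_length[OF as(1)] col_length[OF bs(1)]
    have "map ent ls = map ent (merge I as' bs')"
      using 1 as bs by (simp add: map_merge[OF I])
    moreover have "set (merge I as' bs') \<subseteq> leaves"
      using set_merge[OF I] col_subset[OF as(1)] col_subset[OF bs(1)] below_subset(2) by blast
    ultimately have "ls = merge I as' bs'" using assms(2) by (intro map_ent_eq)
    then show ?thesis using 1 as bs by blast
  next
    case (2 i \<kappa>)
    then obtain ls' where "col (s @ [i]) \<kappa> ls'" "map ent ls = map ent ls'" using colored_imp_col by metis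
    moreover then have "ls = ls'"
      using assms(2) below_subset(2) col_subset by (intro map_ent_eq) blast+
    ultimately show ?thesis using 2 by blast
  qed
next
  have nl: "\<not> pseudoleaf T s" using assms by simp
  assume "?A \<or> ?M"
  then show "(R, map ent ls) \<in> atoms_at \<Sigma> L T s"
  proof (elim disjE exE conjE)
    fix \<kappa> \<mu> I as bs
    assume *: "Instr (RAdd \<kappa> \<mu> I R) \<in> T s" "ls = merge I as bs" "col (s @ [False]) \<kappa> as" "col (s @ [True]) \<mu> bs"
    note I = RAddD[OF *(1)] col_length[OF *(3)] col_length[OF *(4)]
    show ?thesis
      using * nl unfolding col_def atoms_at_def *(2) map_merge[OF I] by auto
  next
    fix i \<kappa> assume "Instr (Mat i \<kappa> R) \<in> T s" "col (s @ [i]) \<kappa> ls"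
    then show ?thesis using nl unfolding col_def atoms_at_def by auto
  qed
qed

lemma atoms_at_leaf:
  assumes "s \<in> leaves"
  shows "atoms_at \<Sigma> L T s = {(top_sym \<Sigma>, [ent s])}"
proof -
  have leaf: "pseudoleaf T s" using assms by simp
  then obtain d where d: "T s = {d}" using leaf_decor by blast
  show ?thesis
  proof (cases d)
    case Star
    then show ?thesis using leaf d ent_Star[of s] by (simp add: atoms_at_def)
  next
    case (DConst c)
    then show ?thesis using leaf d ent_DConst[of c s] by (simp add: atoms_at_def)
  qed (use leaf d in \<open>simp add: pseudoleaf_def\<close>)
qed

lemma atoms_at_entities:
  assumes "(R, e) \<in> atoms_at \<Sigma> L T s"
  shows "\<exists>ls. set ls \<subseteq> below s \<and> e = map ent ls"
proof (cases "s \<in> leaves")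
  case True
  then have "set [s] \<subseteq> below s \<and> e = map ent [s]"
    using assms by (simp add: atoms_at_leaf below_leaf)
  then show ?thesis by blast
next
  case False
  with assms consider \<kappa> \<mu> I as bs where "Instr (RAdd \<kappa> \<mu> I R) \<in> T s" "e = merge I as bs"
      "colored \<Sigma> L T (s @ [False]) \<kappa> as" "colored \<Sigma> L T (s @ [True]) \<mu> bs"
    | i \<kappa> where "Instr (Mat i \<kappa> R) \<in> T s" "colored \<Sigma> L T (s @ [i]) \<kappa> e"
    unfolding atoms_at_def by auto
  then show ?thesis
  proof cases
    case (1 \<kappa> \<mu> I as bs)
    obtain as' where as: "col (s @ [False]) \<kappa> as'" "as = map ent as'" using colored_imp_col 1 by metis
    obtain bs' where bs: "col (s @ [True]) \<mu> bs'" "bs = map ent bs'" using colored_imp_col 1 by metis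
    note I = RAddD[OF 1(1)] col_length[OF as(1)] col_length[OF bs(1)]
    have "e = map ent (merge I as' bs')" using 1 as bs by (simp add: map_merge[OF I])
    moreover have "set (merge I as' bs') \<subseteq> below s"
      using set_merge[OF I] col_subset[OF as(1)] col_subset[OF bs(1)] below_subset(1) by blast
    ultimately show ?thesis by blast
  next
    case (2 i \<kappa>)
    then show ?thesis using colored_entities[OF 2(2)] below_subset(1) by blast
  qed
qed

text \<open>Makes \<open>atom_type\<close> local: an atom generated inside the subtree of
  \<open>s\<close> mentions no leaf outside it.\<close>

lemma atoms_at_below:
  assumes "(R, map ent ls) \<in> atoms_at \<Sigma> L T s" "set ls \<subseteq> leaves"
  shows "set ls \<subseteq> below s"
proof -
  obtain ls' where "set ls' \<subseteq> below s" "map ent ls = map ent ls'"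
    using atoms_at_entities[OF assms(1)] by blast
  moreover then have "ls = ls'" using assms(2) below_subset(2) by (intro map_ent_eq) blast+
  ultimately show ?thesis by simp
qed

lemma adom_represented: "adom (represented \<Sigma> L T) = ent ` leaves"
proof
  show "adom (represented \<Sigma> L T) \<subseteq> ent ` leaves"
    unfolding adom_def represented_def using atoms_at_entities below_subset(2) by fastforce
  show "ent ` leaves \<subseteq> adom (represented \<Sigma> L T)"
  proof
    fix t assume "t \<in> ent ` leaves"
    then obtain l where "l \<in> leaves" "t = ent l" by blast
    then have "(top_sym \<Sigma>, [t]) \<in> represented \<Sigma> L T"
      using atoms_at_leaf[of l] by (auto simp: represented_def)
    then show "t \<in> adom (represented \<Sigma> L T)" unfolding adom_def by force
  qed
qed

section \<open>Types for atomic formulas\<close>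

context
  fixes us :: "'v list" and R :: 'r
begin

text \<open>Arguments are valued by sets, so an atom asks for one leaf from each set such that the
  leaves are related. While such a choice is being assembled, it covers only some of the arguments;
  \<open>vs\<close> lists these, and its length is fixed by the arity of \<kappa>.\<close>

definition color_type :: "node \<Rightarrow> ('v \<Rightarrow> node set) \<Rightarrow> ('l \<times> 'v list) set" where
  "color_type s \<gamma> = {(\<kappa>, vs). set vs \<subseteq> set us \<and> (\<exists>ls. col s \<kappa> ls \<and> list_all2 (\<lambda>u l. l \<in> \<gamma> u) vs ls)}"

definition atom_type :: "node \<Rightarrow> ('v \<Rightarrow> node set) \<Rightarrow> bool" where
  "atom_type s \<gamma> \<longleftrightarrow> (\<exists>s' ls. set ls \<subseteq> leaves \<and> list_all2 (\<lambda>u l. l \<in> \<gamma> u) us ls \<and>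
     (R, map ent ls) \<in> atoms_at \<Sigma> L T (s @ s'))"

text \<open>Shared by \<open>Add\<close> and \<open>RAdd\<close>: the positions in \<open>I\<close>
  cut the list of arguments exactly as they cut the tuple of leaves.\<close>

lemma color_type_merge:
  assumes "I \<subseteq> {1..color_arity L \<kappa> + color_arity L \<mu>}" "card I = color_arity L \<kappa>"
  shows "(\<exists>vs0 vs1. vs = merge I vs0 vs1 \<and> (\<kappa>, vs0) \<in> color_type (s @ [False]) \<gamma> \<and>
      (\<mu>, vs1) \<in> color_type (s @ [True]) \<gamma>) \<longleftrightarrow>
    set vs \<subseteq> set us \<and> (\<exists>as bs. col (s @ [False]) \<kappa> as \<and> col (s @ [True]) \<mu> bs \<and>
      list_all2 (\<lambda>u l. l \<in> \<gamma> u) vs (merge I as bs))" (is "?l \<longleftrightarrow> ?r")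
proof
  assume ?l
  then obtain vs0 vs1 as bs where *: "vs = merge I vs0 vs1" "set vs0 \<subseteq> set us" "set vs1 \<subseteq> set us"
    "col (s @ [False]) \<kappa> as" "col (s @ [True]) \<mu> bs"
    "list_all2 (\<lambda>u l. l \<in> \<gamma> u) vs0 as" "list_all2 (\<lambda>u l. l \<in> \<gamma> u) vs1 bs"
    unfolding color_type_def by blast
  have len: "length as = color_arity L \<kappa>" "length bs = color_arity L \<mu>"
    "length vs0 = color_arity L \<kappa>" "length vs1 = color_arity L \<mu>"
    using * col_length by (auto dest!: list_all2_lengthD)
  have "list_all2 (\<lambda>u l. l \<in> \<gamma> u) vs (merge I as bs)"
    using * list_all2_merge[OF assms len(3,4,1,2)] by simp
  moreover have "set vs \<subseteq> set us" using * set_merge[OF assms len(3,4)] by simp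
  ultimately show ?r using * by blast
next
  assume ?r
  then obtain as bs where *: "set vs \<subseteq> set us" "col (s @ [False]) \<kappa> as" "col (s @ [True]) \<mu> bs"
    "list_all2 (\<lambda>u l. l \<in> \<gamma> u) vs (merge I as bs)" by blast
  have len: "length as = color_arity L \<kappa>" "length bs = color_arity L \<mu>"
    using * col_length by auto
  then have "length vs = color_arity L \<kappa> + color_arity L \<mu>"
    using list_all2_lengthD[OF *(4)] by simp
  from merge_split[OF assms this] obtain vs0 vs1 where vs: "vs = merge I vs0 vs1"
    "length vs0 = color_arity L \<kappa>" "length vs1 = color_arity L \<mu>" .
  have "list_all2 (\<lambda>u l. l \<in> \<gamma> u) vs0 as" "list_all2 (\<lambda>u l. l \<in> \<gamma> u) vs1 bs"
    using * list_all2_merge[OF assms vs(2,3) len] vs(1) by auto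
  moreover have "set vs0 \<union> set vs1 \<subseteq> set us" using *(1) set_merge[OF assms vs(2,3)] vs(1) by simp
  ultimately show ?l using * vs unfolding color_type_def by blast
qed

lemma color_type_nonleaf:
  assumes "s \<notin> leaves"
  shows "(\<nu>, vs) \<in> color_type s \<gamma> \<longleftrightarrow>
    (\<exists>\<kappa> \<mu> I. Instr (Add \<kappa> \<mu> I \<nu>) \<in> T s \<and> (\<exists>vs0 vs1. vs = merge I vs0 vs1 \<and>
       (\<kappa>, vs0) \<in> color_type (s @ [False]) \<gamma> \<and> (\<mu>, vs1) \<in> color_type (s @ [True]) \<gamma>)) \<or>
    (\<exists>i \<kappa>. Instr (Recol i \<kappa> \<nu>) \<in> T s \<and> (\<kappa>, vs) \<in> color_type (s @ [i]) \<gamma>) \<or>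
    (\<exists>i. (\<forall>\<kappa>. Instr (Recol i \<nu> \<kappa>) \<notin> T s) \<and> (\<nu>, vs) \<in> color_type (s @ [i]) \<gamma>)"
proof -
  have "(\<exists>\<kappa> \<mu> I. Instr (Add \<kappa> \<mu> I \<nu>) \<in> T s \<and> (\<exists>vs0 vs1. vs = merge I vs0 vs1 \<and>
       (\<kappa>, vs0) \<in> color_type (s @ [False]) \<gamma> \<and> (\<mu>, vs1) \<in> color_type (s @ [True]) \<gamma>)) \<longleftrightarrow>
    (\<exists>\<kappa> \<mu> I. Instr (Add \<kappa> \<mu> I \<nu>) \<in> T s \<and> set vs \<subseteq> set us \<and>
      (\<exists>as bs. col (s @ [False]) \<kappa> as \<and> col (s @ [True]) \<mu> bs \<and>
      list_all2 (\<lambda>u l. l \<in> \<gamma> u) vs (merge I as bs)))"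
    by (intro ex_cong1 conj_cong refl color_type_merge) (use AddD(1,2) in blast)+
  then show ?thesis
    unfolding color_type_def[of s] mem_Collect_eq case_prod_conv col_nonleaf[OF assms]
    by (simp only: color_type_def mem_Collect_eq case_prod_conv) blast
qed

text \<open>Atoms created at \<open>s\<close> itself are read off the color types of the children;
  all others are created inside the subtree of one child.\<close>

lemma atom_type_nonleaf:
  assumes "s \<notin> leaves"
  shows "atom_type s \<gamma> \<longleftrightarrow> atom_type (s @ [False]) \<gamma> \<or> atom_type (s @ [True]) \<gamma> \<or>
    (\<exists>\<kappa> \<mu> I. Instr (RAdd \<kappa> \<mu> I R) \<in> T s \<and> (\<exists>vs0 vs1. us = merge I vs0 vs1 \<and>
       (\<kappa>, vs0) \<in> color_type (s @ [False]) \<gamma> \<and> (\<mu>, vs1) \<in> color_type (s @ [True]) \<gamma>)) \<or>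
    (\<exists>i \<kappa>. Instr (Mat i \<kappa> R) \<in> T s \<and> (\<kappa>, us) \<in> color_type (s @ [i]) \<gamma>)" (is "_ \<longleftrightarrow> ?f \<or> ?t \<or> ?A \<or> ?M")
proof -
  let ?at = "\<lambda>s. \<exists>ls. set ls \<subseteq> leaves \<and> list_all2 (\<lambda>u l. l \<in> \<gamma> u) us ls \<and>
     (R, map ent ls) \<in> atoms_at \<Sigma> L T s"
  have A: "?A \<longleftrightarrow> (\<exists>\<kappa> \<mu> I. Instr (RAdd \<kappa> \<mu> I R) \<in> T s \<and> set us \<subseteq> set us \<and>
      (\<exists>as bs. col (s @ [False]) \<kappa> as \<and> col (s @ [True]) \<mu> bs \<and>
      list_all2 (\<lambda>u l. l \<in> \<gamma> u) us (merge I as bs)))"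
    by (intro ex_cong1 conj_cong refl color_type_merge) (use RAddD in blast)+
  have M: "?M \<longleftrightarrow> (\<exists>i \<kappa>. Instr (Mat i \<kappa> R) \<in> T s \<and> 
      (\<exists>ls. col (s @ [i]) \<kappa> ls \<and> list_all2 (\<lambda>u l. l \<in> \<gamma> u) us ls))"
    by (simp add: color_type_def)
  have merge_leaves: "set (merge I as bs) \<subseteq> leaves"
    if "Instr (RAdd \<kappa> \<mu> I R) \<in> T s" "col (s @ [False]) \<kappa> as" "col (s @ [True]) \<mu> bs" for \<kappa> \<mu> I as bs
    using set_merge[OF RAddD[OF that(1)] col_length[OF that(2)] col_length[OF that(3)]]
      col_subset[OF that(2)] col_subset[OF that(3)] below_subset(2) by blast
  have col_leaves: "set ls \<subseteq> leaves" if "col s' \<kappa> ls" for s' \<kappa> ls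
    using col_subset[OF that] below_subset(2) by blast
  have at: "?at s \<longleftrightarrow> ?A \<or> ?M"
    unfolding A M
  proof (intro iffI; (elim exE conjE disjE)?)
    fix ls assume ls: "set ls \<subseteq> leaves" "list_all2 (\<lambda>u l. l \<in> \<gamma> u) us ls"
      "(R, map ent ls) \<in> atoms_at \<Sigma> L T s"
    from ls(3)[unfolded atoms_at_nonleaf[OF assms ls(1)]] ls(2)
    show "(\<exists>\<kappa> \<mu> I. Instr (RAdd \<kappa> \<mu> I R) \<in> T s \<and> set us \<subseteq> set us \<and>
      (\<exists>as bs. col (s @ [False]) \<kappa> as \<and> col (s @ [True]) \<mu> bs \<and>
      list_all2 (\<lambda>u l. l \<in> \<gamma> u) us (merge I as bs))) \<or> (\<exists>i \<kappa>. Instr (Mat i \<kappa> R) \<in> T s \<and>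
      (\<exists>ls. col (s @ [i]) \<kappa> ls \<and> list_all2 (\<lambda>u l. l \<in> \<gamma> u) us ls))"
      by blast
  next
    fix \<kappa> \<mu> I as bs
    assume *: "Instr (RAdd \<kappa> \<mu> I R) \<in> T s" "col (s @ [False]) \<kappa> as" "col (s @ [True]) \<mu> bs"
      "list_all2 (\<lambda>u l. l \<in> \<gamma> u) us (merge I as bs)"
    then show "?at s"
      using atoms_at_nonleaf[OF assms merge_leaves[OF *(1-3)], of R] merge_leaves[OF *(1-3)] by blast
  next
    fix i \<kappa> ls
    assume *: "Instr (Mat i \<kappa> R) \<in> T s" "col (s @ [i]) \<kappa> ls" "list_all2 (\<lambda>u l. l \<in> \<gamma> u) us ls"
    then show "?at s"
      using atoms_at_nonleaf[OF assms col_leaves[OF *(2)], of R] col_leaves[OF *(2)] by blast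
  qed
  have split: "(\<exists>s'. P (s @ s')) \<longleftrightarrow> P s \<or> (\<exists>s'. P ((s @ [False]) @ s')) \<or> (\<exists>s'. P ((s @ [True]) @ s'))"
    for P :: "node \<Rightarrow> bool"
  proof
    assume "\<exists>s'. P (s @ s')"
    then obtain s' where s': "P (s @ s')" by blast
    show "P s \<or> (\<exists>s'. P ((s @ [False]) @ s')) \<or> (\<exists>s'. P ((s @ [True]) @ s'))"
    proof (cases s')
      case (Cons b s'')
      with s' show ?thesis by (cases b) auto
    qed (use s' in simp)
  qed (metis append.assoc append_Nil2)
  have "atom_type s \<gamma> \<longleftrightarrow> (\<exists>s'. ?at (s @ s'))" for s
    by (simp add: atom_type_def)
  then show ?thesis using split[of ?at] at by metis
qed

lemma recog_atom:
  "recog (\<lambda>\<gamma>. \<exists>ls. set ls \<subseteq> leaves \<and> list_all2 (\<lambda>u l. l \<in> \<gamma> u) us ls \<and>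
     (R, map ent ls) \<in> represented \<Sigma> L T)"
proof (rule recogI)
  \<comment> \<open>The finitely many colors have bounded arity, which bounds the argument lists in
    a color type and makes the range finite.\<close>
  let ?n = "Max (color_arity L ` colors L)"
  let ?F = "Pow (colors L \<times> {vs. set vs \<subseteq> set us \<and> length vs \<le> ?n}) \<times> (UNIV :: bool set)"
  have fin: "finite (colors L)" using coloring by (simp add: is_coloring_def)
  have loc: "list_all2 (\<lambda>u l. l \<in> \<gamma> u) vs ls \<longleftrightarrow> list_all2 (\<lambda>u l. l \<in> \<gamma>' u) vs ls"
    if "\<And>v. \<gamma> v \<inter> below s = \<gamma>' v \<inter> below s" "set ls \<subseteq> below s" for s \<gamma> \<gamma>' and vs :: "'v list" and ls
    using that by (intro list.rel_cong refl) blast+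
  show "compositional (\<lambda>s \<gamma>. (color_type s \<gamma>, atom_type s \<gamma>))"
  proof (rule compositionalI[where F = ?F])
    show "finite ?F" using fin finite_lists_length_le[of "set us" ?n] by simp
    show "(color_type s \<gamma>, atom_type s \<gamma>) \<in> ?F" for s \<gamma>
    proof -
      have "\<kappa> \<in> colors L \<and> length vs \<le> ?n" if "col s \<kappa> ls" "list_all2 (\<lambda>u l. l \<in> \<gamma> u) vs ls" for \<kappa> vs ls
        using col_color[OF that(1)] col_length[OF that(1)] list_all2_lengthD[OF that(2)] fin by auto
      then show ?thesis unfolding color_type_def by auto
    qed
    show "(color_type s \<gamma>, atom_type s \<gamma>) = (color_type s \<gamma>', atom_type s \<gamma>')"
      if eq: "\<And>v. \<gamma> v \<inter> below s = \<gamma>' v \<inter> below s" for s \<gamma> \<gamma>'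
    proof -
      have "color_type s \<gamma> = color_type s \<gamma>'"
        unfolding color_type_def using loc[OF eq] col_subset by (simp cong: conj_cong)
      moreover have "list_all2 (\<lambda>u l. l \<in> \<gamma> u) us ls \<longleftrightarrow> list_all2 (\<lambda>u l. l \<in> \<gamma>' u) us ls"
        if "(R, map ent ls) \<in> atoms_at \<Sigma> L T (s @ s')" "set ls \<subseteq> leaves" for ls s'
        using atoms_at_below[OF that] below_subset(1) by (intro loc[OF eq]) blast
      then have "atom_type s \<gamma> = atom_type s \<gamma>'"
        unfolding atom_type_def by blast
      ultimately show ?thesis by simp
    qed
    show "(color_type s \<gamma>, atom_type s \<gamma>) = (color_type s \<gamma>', atom_type s \<gamma>')"
      if "s \<notin> leaves"
        "(color_type (s @ [False]) \<gamma>, atom_type (s @ [False]) \<gamma>) = (color_type (s @ [False]) \<gamma>', atom_type (s @ [False]) \<gamma>')"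
        "(color_type (s @ [True]) \<gamma>, atom_type (s @ [True]) \<gamma>) = (color_type (s @ [True]) \<gamma>', atom_type (s @ [True]) \<gamma>')"
      for s \<gamma> \<gamma>'
    proof -
      have i: "color_type (s @ [i]) \<gamma> = color_type (s @ [i]) \<gamma>'" for i using that by (cases i) auto
      have "atom_type (s @ [False]) \<gamma> = atom_type (s @ [False]) \<gamma>'"
        "atom_type (s @ [True]) \<gamma> = atom_type (s @ [True]) \<gamma>'" using that(2,3) by simp_all
      then have "atom_type s \<gamma> = atom_type s \<gamma>'"
        unfolding atom_type_nonleaf[OF that(1)] i by simp
      moreover have "color_type s \<gamma> = color_type s \<gamma>'"
        by (intro set_eqI, simp only: split_paired_all color_type_nonleaf[OF that(1)] i)
      ultimately show ?thesis by simp
    qed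
  qed
  show "decides (\<lambda>s \<gamma>. (color_type s \<gamma>, atom_type s \<gamma>)) (\<lambda>\<gamma>. \<exists>ls. set ls \<subseteq> leaves \<and>
     list_all2 (\<lambda>u l. l \<in> \<gamma> u) us ls \<and> (R, map ent ls) \<in> represented \<Sigma> L T)"
  proof (rule decidesI)
    fix \<gamma> \<gamma>'
    assume "(color_type [] \<gamma>, atom_type [] \<gamma>) = (color_type [] \<gamma>', atom_type [] \<gamma>')"
      "\<exists>ls. set ls \<subseteq> leaves \<and> list_all2 (\<lambda>u l. l \<in> \<gamma> u) us ls \<and> (R, map ent ls) \<in> represented \<Sigma> L T"
    then have "atom_type [] \<gamma>'" unfolding atom_type_def represented_def by auto
    then show "\<exists>ls. set ls \<subseteq> leaves \<and> list_all2 (\<lambda>u l. l \<in> \<gamma>' u) us ls \<and> (R, map ent ls) \<in> represented \<Sigma> L T"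
      unfolding atom_type_def represented_def by auto
  qed
qed

end

end

section \<open>Formulas evaluated in an instance that has a tree\<close>

locale tree_model = decorated_tree \<Sigma> L C T
  for \<Sigma> :: "'r signature" and L :: "'l coloring" and C :: "'c set" and T :: "('l, 'r, 'c) tree" +
  fixes B :: "('r, 'c, 'n) atoms" and g :: "node \<Rightarrow> ('c, 'n) trm"
  assumes bij_g: "bij_betw g leaves (adom B)"
    and atom_g: "set ls \<subseteq> leaves \<Longrightarrow> (R, map g ls) \<in> B \<longleftrightarrow> (R, map ent ls) \<in> represented \<Sigma> L T"
begin

lemma g_image: "g ` leaves = adom B"
  using bij_g by (simp add: bij_betw_def)

lemma g_inj: "l \<in> leaves \<Longrightarrow> l' \<in> leaves \<Longrightarrow> g l = g l' \<longleftrightarrow> l = l'"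
  using bij_g by (auto simp: bij_betw_def inj_on_def)

text \<open>Terms and set variables alike are valued by sets of leaves: a term by the at most one leaf
  that carries its value.\<close>

definition agrees :: "('r, 'c) mso \<Rightarrow> (nat \<Rightarrow> ('c, 'n) trm) \<Rightarrow> (nat \<Rightarrow> ('c, 'n) trm set) \<Rightarrow>
    ('c mso_term + nat \<Rightarrow> node set) \<Rightarrow> bool" where
  "agrees \<phi> \<alpha> \<beta> \<gamma> \<longleftrightarrow>
     (\<forall>x\<in>free_vars \<phi>. \<alpha> x \<in> adom B \<and> \<gamma> (Inl (V x)) = {l \<in> leaves. g l = \<alpha> x}) \<and>
     (\<forall>X\<in>free_set_vars \<phi>. \<beta> X \<subseteq> adom B \<and> \<gamma> (Inr X) = {l \<in> leaves. g l \<in> \<beta> X}) \<and>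
     (\<forall>c. \<gamma> (Inl (K c)) = {l \<in> leaves. g l = Const c})"

lemma agrees_term:
  assumes "agrees \<phi> \<alpha> \<beta> \<gamma>" "term_vars u \<subseteq> free_vars \<phi>"
  shows "\<gamma> (Inl u) = {l \<in> leaves. g l = term_val \<alpha> u}"
  using assms by (cases u) (auto simp: agrees_def)

text \<open>\<open>Q\<close> is fixed before the assignments, so the quantifier cases can use the
  induction hypothesis at modified assignments. Free variables take values in the active domain,
  which quantification preserves.\<close>

lemma recog_mso:
  "\<exists>Q. recog Q \<and> (\<forall>\<alpha> \<beta> \<gamma>. agrees \<phi> \<alpha> \<beta> \<gamma> \<longrightarrow> (sat B \<alpha> \<beta> \<phi> \<longleftrightarrow> Q \<gamma>))"
proof (induction \<phi>)
  case (Rel R us)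
  let ?Q = "\<lambda>\<gamma>. \<exists>ls. set ls \<subseteq> leaves \<and> list_all2 (\<lambda>u l. l \<in> \<gamma> u) (map Inl us) ls \<and>
     (R, map ent ls) \<in> represented \<Sigma> L T"
  have "sat B \<alpha> \<beta> (Rel R us) \<longleftrightarrow> ?Q \<gamma>" if "agrees (Rel R us) \<alpha> \<beta> \<gamma>" for \<alpha> \<beta> \<gamma>
  proof -
    have \<gamma>: "\<gamma> (Inl u) = {l \<in> leaves. g l = term_val \<alpha> u}" if "u \<in> set us" for u
      using that by (intro agrees_term[OF \<open>agrees _ _ _ _\<close>]) auto
    have \<gamma>': "list_all2 (\<lambda>u l. l \<in> \<gamma> u) (map Inl us) ls \<longleftrightarrow>
        set ls \<subseteq> leaves \<and> map g ls = map (term_val \<alpha>) us" for ls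
    proof -
      have "list_all2 (\<lambda>u l. l \<in> \<gamma> u) (map Inl us) ls \<longleftrightarrow>
          list_all2 (\<lambda>u l. l \<in> leaves \<and> g l = term_val \<alpha> u) us ls"
        unfolding list.rel_map by (intro list.rel_cong refl) (use \<gamma> in auto)
      also have "\<dots> \<longleftrightarrow> set ls \<subseteq> leaves \<and> map g ls = map (term_val \<alpha>) us"
        unfolding list_all2_conv_all_nth list_eq_iff_nth_eq subset_code(1) all_set_conv_all_nth
        by auto
      finally show ?thesis .
    qed
    show ?thesis
    proof
      assume "sat B \<alpha> \<beta> (Rel R us)"
      then have at: "(R, map (term_val \<alpha>) us) \<in> B" by simp
      then have "map (term_val \<alpha>) us \<in> lists (g ` leaves)"
        unfolding g_image adom_def by force
      then obtain ls where "set ls \<subseteq> leaves" "map g ls = map (term_val \<alpha>) us"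
        unfolding lists_image by (auto simp: subset_eq)
      then show "?Q \<gamma>" using at atom_g[of ls R] \<gamma>' by metis
    next
      assume "?Q \<gamma>"
      then obtain ls where "set ls \<subseteq> leaves" "map g ls = map (term_val \<alpha>) us"
        "(R, map ent ls) \<in> represented \<Sigma> L T" using \<gamma>' by blast
      then show "sat B \<alpha> \<beta> (Rel R us)" using atom_g[of ls R] by simp
    qed
  qed
  then show ?case using recog_atom[of "map Inl us" R] by blast
next
  case (Equal u v)
  show ?case
  \<comment> \<open>Constants may be absent from the instance; their leaf sets are then empty even
    if they are equal, so the comparison of two constants is treated as a fixed truth value.
    Otherwise one side is a variable, and its value has a leaf.\<close>
  proof (cases "\<exists>c d. u = K c \<and> v = K d")
    case True
    then show ?thesis using recog_const by fastforce
  next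
    case False
    have "sat B \<alpha> \<beta> (Equal u v) \<longleftrightarrow> \<gamma> (Inl u) \<inter> \<gamma> (Inl v) \<inter> leaves \<noteq> {}"
      if "agrees (Equal u v) \<alpha> \<beta> \<gamma>" for \<alpha> \<beta> \<gamma>
    proof -
      have "term_val \<alpha> u \<in> g ` leaves \<or> term_val \<alpha> v \<in> g ` leaves"
        using that False unfolding g_image by (cases u; cases v) (auto simp: agrees_def)
      then show ?thesis using agrees_term[OF that, of u] agrees_term[OF that, of v] by auto
    qed
    then show ?thesis using recog_meet[of "Inl u" "Inl v"] by blast
  qed
next
  case (Elem u X)
  have "sat B \<alpha> \<beta> (Elem u X) \<longleftrightarrow> \<gamma> (Inl u) \<inter> \<gamma> (Inr X) \<inter> leaves \<noteq> {}"
    if "agrees (Elem u X) \<alpha> \<beta> \<gamma>" for \<alpha> \<beta> \<gamma>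
  proof -
    have X: "\<gamma> (Inr X) = {l \<in> leaves. g l \<in> \<beta> X}" "\<beta> X \<subseteq> g ` leaves"
      using that unfolding g_image by (simp_all add: agrees_def)
    have u: "\<gamma> (Inl u) = {l \<in> leaves. g l = term_val \<alpha> u}" by (rule agrees_term[OF that]) simp
    show ?thesis
    proof
      assume "sat B \<alpha> \<beta> (Elem u X)"
      then have "term_val \<alpha> u \<in> \<beta> X" by simp
      \<comment> \<open>A constant outside the active domain belongs to no \<open>\<beta> X\<close>,
        so a member always has a leaf.\<close>
      moreover from this X(2) obtain l where "l \<in> leaves" "term_val \<alpha> u = g l" by blast
      ultimately have "l \<in> \<gamma> (Inl u) \<inter> \<gamma> (Inr X) \<inter> leaves" unfolding u X(1) by simp
      then show "\<gamma> (Inl u) \<inter> \<gamma> (Inr X) \<inter> leaves \<noteq> {}" by blast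
    qed (auto simp: u X(1))
  qed
  then show ?case using recog_meet[of "Inl u" "Inr X"] by blast
next
  case (Neg \<phi>)
  then obtain Q where "recog Q" "\<And>\<alpha> \<beta> \<gamma>. agrees \<phi> \<alpha> \<beta> \<gamma> \<Longrightarrow> sat B \<alpha> \<beta> \<phi> \<longleftrightarrow> Q \<gamma>" by blast
  then show ?case
    by (intro exI[of _ "\<lambda>\<gamma>. \<not> Q \<gamma>"] conjI recog_not) (auto simp: agrees_def)
next
  case (Conj \<phi> \<psi>)
  then obtain Q Q' where Q: "recog Q" "\<And>\<alpha> \<beta> \<gamma>. agrees \<phi> \<alpha> \<beta> \<gamma> \<Longrightarrow> sat B \<alpha> \<beta> \<phi> \<longleftrightarrow> Q \<gamma>"
    "recog Q'" "\<And>\<alpha> \<beta> \<gamma>. agrees \<psi> \<alpha> \<beta> \<gamma> \<Longrightarrow> sat B \<alpha> \<beta> \<psi> \<longleftrightarrow> Q' \<gamma>" by blast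
  have "agrees \<phi> \<alpha> \<beta> \<gamma> \<and> agrees \<psi> \<alpha> \<beta> \<gamma>" if "agrees (Conj \<phi> \<psi>) \<alpha> \<beta> \<gamma>" for \<alpha> \<beta> \<gamma>
    using that by (auto simp: agrees_def)
  then have "sat B \<alpha> \<beta> (Conj \<phi> \<psi>) \<longleftrightarrow> Q \<gamma> \<and> Q' \<gamma>" if "agrees (Conj \<phi> \<psi>) \<alpha> \<beta> \<gamma>" for \<alpha> \<beta> \<gamma>
    using Q(2)[of \<alpha> \<beta> \<gamma>] Q(4)[of \<alpha> \<beta> \<gamma>] that by simp
  then show ?case using recog_conj[OF Q(1,3)] by blast
next
  case (Exists x \<phi>)
  then obtain Q where Q: "recog Q" "\<And>\<alpha> \<beta> \<gamma>. agrees \<phi> \<alpha> \<beta> \<gamma> \<Longrightarrow> sat B \<alpha> \<beta> \<phi> \<longleftrightarrow> Q \<gamma>" by blast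
  have "sat B \<alpha> \<beta> (Exists x \<phi>) \<longleftrightarrow> (\<exists>l\<in>leaves. Q (\<gamma>(Inl (V x) := {l})))"
    if "agrees (Exists x \<phi>) \<alpha> \<beta> \<gamma>" for \<alpha> \<beta> \<gamma>
  proof -
    have "sat B (\<alpha>(x := g l)) \<beta> \<phi> \<longleftrightarrow> Q (\<gamma>(Inl (V x) := {l}))" if "l \<in> leaves" for l
    proof (rule Q(2))
      have "{l} = {l' \<in> leaves. g l' = g l}" "g l \<in> adom B" using that g_inj g_image by auto
      then show "agrees \<phi> (\<alpha>(x := g l)) \<beta> (\<gamma>(Inl (V x) := {l}))"
        using \<open>agrees (Exists x \<phi>) \<alpha> \<beta> \<gamma>\<close> by (simp add: agrees_def)
    qed
    then show ?thesis unfolding sat.simps g_image[symmetric] by simp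
  qed
  then show ?case using recog_exists[OF Q(1), of "Inl (V x)"] by blast
next
  case (ExistsSet X \<phi>)
  then obtain Q where Q: "recog Q" "\<And>\<alpha> \<beta> \<gamma>. agrees \<phi> \<alpha> \<beta> \<gamma> \<Longrightarrow> sat B \<alpha> \<beta> \<phi> \<longleftrightarrow> Q \<gamma>" by blast
  have "sat B \<alpha> \<beta> (ExistsSet X \<phi>) \<longleftrightarrow> (\<exists>S\<subseteq>leaves. Q (\<gamma>(Inr X := S)))"
    if "agrees (ExistsSet X \<phi>) \<alpha> \<beta> \<gamma>" for \<alpha> \<beta> \<gamma>
  proof -
    have "sat B \<alpha> (\<beta>(X := g ` S)) \<phi> \<longleftrightarrow> Q (\<gamma>(Inr X := S))" if "S \<subseteq> leaves" for S
    proof (rule Q(2))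
      have "S = {l \<in> leaves. g l \<in> g ` S}" using that g_inj by auto
      moreover have "g ` S \<subseteq> adom B" unfolding g_image[symmetric] using that by blast
      ultimately show "agrees \<phi> \<alpha> (\<beta>(X := g ` S)) (\<gamma>(Inr X := S))"
        using \<open>agrees (ExistsSet X \<phi>) \<alpha> \<beta> \<gamma>\<close> by (simp add: agrees_def)
    qed
    then show ?thesis unfolding sat.simps g_image[symmetric] by (metis subset_imageE image_mono)
  qed
  then show ?case using recog_exists_set[OF Q(1), of "Inr X"] by blast
qed

end

subsection \<open>Trees from compositional colorings of tuples\<close>

text \<open>What a coloring of tuples must satisfy to be realized by instructions.
  \<open>c_child\<close> and \<open>c_merge\<close> rule out incompatible \<open>Recol\<close> and
  \<open>Add\<close>, \<open>c_leaf\<close> is forced by the colors of a pseudoleaf, and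
  \<open>c_root\<close> lets \<open>Mat\<close> produce atoms from root colors alone.
  \<open>P\<close> contains one leaf for each element of \<open>A\<close>, and \<open>F\<close> is
  the correspondence.\<close>

locale tuple_coloring = leaf_tree Lv
  for Lv :: "node set" +
  fixes \<Sigma> :: "'s signature" and C :: "'d set" and L :: "'l coloring"
    and P :: "node set" and F :: "node \<Rightarrow> ('d, 'n) trm" and A :: "('s, 'd, 'n) atoms"
    and c :: "node \<Rightarrow> node list \<Rightarrow> 'l"
    and tup :: "node \<Rightarrow> node list \<Rightarrow> bool"
  defines tup_def: "tup \<equiv> \<lambda>s e. set e \<subseteq> P \<inter> below s \<and> e \<noteq> [] \<and> length e \<le> max_arity \<Sigma>"
  assumes sig: "is_signature \<Sigma>" and coloring: "is_coloring \<Sigma> L" and P: "P \<subseteq> Lv"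
    and c_color: "tup s e \<Longrightarrow> c s e \<in> colors L \<and> color_arity L (c s e) = length e"
    and c_leaf: "s \<in> Lv \<Longrightarrow> tup s e \<Longrightarrow> c s e = leaf_color L (length e)"
    and c_child: "s \<notin> Lv \<Longrightarrow> tup (s @ [i]) e \<Longrightarrow> tup (s @ [i]) e' \<Longrightarrow>
      c (s @ [i]) e = c (s @ [i]) e' \<Longrightarrow> c s e = c s e'"
    and c_merge: "s \<notin> Lv \<Longrightarrow> tup (s @ [False]) as \<Longrightarrow> tup (s @ [False]) as' \<Longrightarrow>
      tup (s @ [True]) bs \<Longrightarrow> tup (s @ [True]) bs' \<Longrightarrow>
      c (s @ [False]) as = c (s @ [False]) as' \<Longrightarrow> c (s @ [True]) bs = c (s @ [True]) bs' \<Longrightarrow>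
      length as + length bs \<le> max_arity \<Sigma> \<Longrightarrow>
      I \<subseteq> {1..length as + length bs} \<Longrightarrow> card I = length as \<Longrightarrow>
      c s (merge I as bs) = c s (merge I as' bs')"
    and c_root: "tup [] e \<Longrightarrow> tup [] e' \<Longrightarrow> c [] e = c [] e' \<Longrightarrow>
      (R, map F e) \<in> A \<Longrightarrow> (R, map F e') \<in> A"
    and inj_F: "inj_on F P" and range_F: "F ` P \<subseteq> range Null \<union> Const ` C"
    and top_A: "l \<in> P \<Longrightarrow> (top_sym \<Sigma>, [F l]) \<in> A"
    and A: "(R, ts) \<in> A \<Longrightarrow> R \<in> rels \<Sigma> \<and> length ts = arity \<Sigma> R \<and> set ts \<subseteq> F ` P"
begin

text \<open>The left subtree of the root is a copy of the given tree. Every color realized at a child is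
  recolored explicitly, so that no tuple is ever kept implicitly.\<close>

definition dec :: "node \<Rightarrow> ('l, 's, 'd) decorator set" where
  "dec s =
     (if s \<in> Lv then (if s \<in> P then {case F s of Const d \<Rightarrow> DConst d | Null _ \<Rightarrow> Star} else {})
      else {Instr (Add (c (s @ [False]) as) (c (s @ [True]) bs) I (c s (merge I as bs))) | as bs I.
              tup (s @ [False]) as \<and> tup (s @ [True]) bs \<and> length as + length bs \<le> max_arity \<Sigma> \<and>
              I \<subseteq> {1..length as + length bs} \<and> card I = length as} \<union>
           {Instr (Recol i (c (s @ [i]) e) (c s e)) | i e. tup (s @ [i]) e})"

text \<open>The old root could not serve for the atoms: \<open>Mat\<close> sees only the colors of a
  child, and the old root may itself be a leaf, where no instruction is allowed.\<close>

definition new_tree :: "('l, 's, 'd) tree" where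
  "new_tree s = (case s of
     [] \<Rightarrow> {Instr (Mat False (c [] e) R) | e R. tup [] e \<and> (R, map F e) \<in> A}
   | b # s' \<Rightarrow> if b then {} else dec s')"

lemma new_tree_simps [simp]:
  "new_tree [] = {Instr (Mat False (c [] e) R) | e R. tup [] e \<and> (R, map F e) \<in> A}"
  "new_tree (False # s) = dec s" "new_tree (True # s) = {}"
  by (simp_all add: new_tree_def)

text \<open>The nulls of a represented instance are nodes of its tree, and each leaf has moved into
  the left subtree.\<close>

definition new_ent :: "node \<Rightarrow> ('d, node) trm" where
  "new_ent l = (case F l of Const d \<Rightarrow> Const d | Null _ \<Rightarrow> Null (False # l))"

lemma dec_leaf: "s \<in> P \<Longrightarrow> dec s = {case F s of Const d \<Rightarrow> DConst d | Null _ \<Rightarrow> Star}"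
  using P by (auto simp: dec_def)

lemma dec_Star: "Star \<in> dec s \<longleftrightarrow> s \<in> P \<and> (\<exists>n. F s = Null n)"
  using P by (auto simp: dec_def split: trm.splits)

lemma dec_DConst: "DConst d \<in> dec s \<longleftrightarrow> s \<in> P \<and> F s = Const d"
  using P by (auto simp: dec_def split: trm.splits)

lemma dec_Instr: "Instr x \<in> dec s \<Longrightarrow> s \<notin> Lv"
  by (auto simp: dec_def split: trm.splits if_splits)

lemma dec_Add: "Instr (Add \<kappa> \<mu> I \<nu>) \<in> dec s \<longleftrightarrow> s \<notin> Lv \<and> (\<exists>as bs. \<kappa> = c (s @ [False]) as \<and>
    \<mu> = c (s @ [True]) bs \<and> \<nu> = c s (merge I as bs) \<and> tup (s @ [False]) as \<and> tup (s @ [True]) bs \<and>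
    length as + length bs \<le> max_arity \<Sigma> \<and> I \<subseteq> {1..length as + length bs} \<and> card I = length as)"
  by (auto simp: dec_def split: trm.splits)

lemma dec_Recol: "Instr (Recol i \<kappa> \<nu>) \<in> dec s \<longleftrightarrow> s \<notin> Lv \<and>
    (\<exists>e. \<kappa> = c (s @ [i]) e \<and> \<nu> = c s e \<and> tup (s @ [i]) e)"
  by (auto simp: dec_def split: trm.splits)

lemma dec_RAdd: "Instr (RAdd \<kappa> \<mu> I R) \<notin> dec s" and dec_Mat: "Instr (Mat i \<kappa> R) \<notin> dec s"
  by (auto simp: dec_def split: trm.splits)

lemma pseudoleaf_new [simp]:
  "\<not> pseudoleaf new_tree []" "\<not> pseudoleaf new_tree (True # s)"
  "pseudoleaf new_tree (False # s) \<longleftrightarrow> s \<in> P"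
proof -
  show "pseudoleaf new_tree (False # s) \<longleftrightarrow> s \<in> P"
    by (cases "F s") (auto simp: pseudoleaf_def dec_Star dec_DConst)
qed (auto simp: pseudoleaf_def)

lemma tup_child: "tup (s @ [i]) e \<Longrightarrow> tup s e"
  unfolding tup_def using below_subset(1) by blast

lemma tup_merge:
  assumes "tup (s @ [False]) as" "tup (s @ [True]) bs" "length as + length bs \<le> max_arity \<Sigma>"
    "I \<subseteq> {1..length as + length bs}" "card I = length as"
  shows "tup s (merge I as bs)"
proof -
  have "set (merge I as bs) = set as \<union> set bs" by (rule set_merge[OF assms(4,5)]) auto
  moreover have "set as \<subseteq> P \<inter> below s" "set bs \<subseteq> P \<inter> below s" "as \<noteq> []"
    using tup_child[OF assms(1)] tup_child[OF assms(2)] by (auto simp: tup_def)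
  ultimately show ?thesis unfolding tup_def using assms(3)
    by (auto simp flip: length_greater_0_conv)
qed

lemma arity_le_max: "R \<in> rels \<Sigma> \<Longrightarrow> 1 \<le> arity \<Sigma> R \<and> arity \<Sigma> R \<le> max_arity \<Sigma>"
  using sig by (auto simp: is_signature_def max_arity_def)

lemma A_tup:
  assumes "(R, map F e) \<in> A" "set e \<subseteq> P"
  shows "tup [] e" "R \<in> rels \<Sigma>" "length e = arity \<Sigma> R"
proof -
  show R: "R \<in> rels \<Sigma>" "length e = arity \<Sigma> R" using A[OF assms(1)] by auto
  then have "1 \<le> length e" "length e \<le> max_arity \<Sigma>" using arity_le_max by auto
  then show "tup [] e" unfolding tup_def using assms(2) P by auto
qed

section \<open>The new tree is well-decorated\<close>

lemma is_instruction_dec: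
  assumes "Instr x \<in> dec s"
  shows "is_instruction \<Sigma> L x"
proof (cases x)
  case (Add \<kappa> \<mu> I \<nu>)
  with assms obtain as bs where *: "\<kappa> = c (s @ [False]) as" "\<mu> = c (s @ [True]) bs"
    "\<nu> = c s (merge I as bs)" "tup (s @ [False]) as" "tup (s @ [True]) bs"
    "length as + length bs \<le> max_arity \<Sigma>" "I \<subseteq> {1..length as + length bs}" "card I = length as"
    by (auto simp: dec_Add)
  \<comment> \<open>Instructions require \<open>I\<close> to be a proper subset, which holds because
    the right part is not empty.\<close>
  have "length bs \<noteq> 0" using *(5) by (simp add: tup_def)
  then have "I \<noteq> {1..length as + length bs}" using *(8) by auto
  then show ?thesis
    using * c_color[OF *(4)] c_color[OF *(5)] c_color[OF tup_merge[OF *(4-8)]] Add by auto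
next
  case (Recol i \<kappa> \<nu>)
  with assms c_color tup_child show ?thesis by (auto simp: dec_Recol)
qed (use assms in \<open>auto simp: dec_RAdd dec_Mat\<close>)

lemma well_decorated_new_tree: "well_decorated L C \<Sigma> new_tree"
  unfolding well_decorated_def
proof (intro conjI allI impI)
  fix s
  have "d \<in> {Star} \<union> DConst ` C \<union> Instr ` {x. is_instruction \<Sigma> L x}" if "d \<in> dec s'" for d s'
  proof (cases d)
    case (DConst c)
    then have "s' \<in> P" "F s' = Const c" using that by (auto simp: dec_DConst)
    then have "c \<in> C" using range_F by auto
    then show ?thesis using DConst by auto
  next
    case (Instr x)
    then show ?thesis using is_instruction_dec that by auto
  qed simp
  moreover have "is_instruction \<Sigma> L (Mat False (c [] e) R)" if "tup [] e" "(R, map F e) \<in> A" for e R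
  proof -
    have "set e \<subseteq> P" using that(1) by (simp add: tup_def)
    then show ?thesis using A_tup[OF that(2)] c_color[OF that(1)] by simp
  qed
  ultimately show "new_tree s \<subseteq> {Star} \<union> DConst ` C \<union> Instr ` {x. is_instruction \<Sigma> L x}"
    unfolding new_tree_def by (cases s) (auto split: if_splits)
next
  fix s assume "pseudoleaf new_tree s"
  then obtain s' where "s = False # s'" "s' \<in> P"
    by (cases s; cases "hd s") auto
  then show "\<exists>d. new_tree s = {d}" by (simp add: dec_leaf)
next
  fix s s' :: node assume s: "pseudoleaf new_tree s \<and> s' \<noteq> []"
  then obtain t where t: "s = False # t" "t \<in> P"
    by (cases s; cases "hd s") auto
  then have tl: "t @ s' \<notin> Lv" using antichain P s by blast
  \<comment> \<open>Strictly below a leaf there are no tuples left, so \<open>dec\<close> produces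
    no instructions there.\<close>
  have "below (t @ s' @ [i]) = {}" for i
    using antichain[of t] t(2) P by (fastforce simp: below_def)
  then have "\<not> tup (t @ s' @ [i]) e" for i e by (auto simp: tup_def)
  then show "new_tree (s @ s') = {}" using tl by (simp add: t dec_def)
next
  fix d s s' assume *: "DConst d \<in> new_tree s \<and> DConst d \<in> new_tree s'"
  then obtain t t' where "s = False # t" "s' = False # t'"
    by (cases s; cases "hd s"; cases s'; cases "hd s'") auto
  with * have "t \<in> P" "t' \<in> P" "F t = F t'" by (auto simp: dec_DConst)
  then show "s = s'" using inj_F \<open>s = False # t\<close> \<open>s' = False # t'\<close> by (auto simp: inj_on_def)
next
  fix s x y assume *: "Instr x \<in> new_tree s \<and> Instr y \<in> new_tree s"
  show "\<not> incompatible x y"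
  proof (cases s)
    case Nil
    then show ?thesis using * by (auto simp: incompatible_def)
  next
    case (Cons b s')
    then have dec: "Instr x \<in> dec s'" "Instr y \<in> dec s'" using * by (cases b; simp)+
    have "\<nu> = \<nu>'" if x: "x = Add \<kappa> \<mu> I \<nu>" and y: "y = Add \<kappa> \<mu> I \<nu>'" for \<kappa> \<mu> I \<nu> \<nu>'
    proof -
      from dec(1) x obtain as bs where 1: "\<kappa> = c (s' @ [False]) as" "\<mu> = c (s' @ [True]) bs"
        "\<nu> = c s' (merge I as bs)" "tup (s' @ [False]) as" "tup (s' @ [True]) bs"
        "length as + length bs \<le> max_arity \<Sigma>" "I \<subseteq> {1..length as + length bs}" "card I = length as"
        by (auto simp: dec_Add)
      from dec(2) y obtain as' bs' where 2: "\<kappa> = c (s' @ [False]) as'" "\<mu> = c (s' @ [True]) bs'"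
        "\<nu>' = c s' (merge I as' bs')" "tup (s' @ [False]) as'" "tup (s' @ [True]) bs'"
        by (auto simp: dec_Add)
      \<comment> \<open>The two instructions may stem from different tuples; as the colors at the
        children agree, \<open>c_merge\<close> makes the resulting colors agree.\<close>
      show ?thesis
        using c_merge[OF dec_Instr[OF dec(1)] 1(4) 2(4) 1(5) 2(5) _ _ 1(6-8)] 1 2 by simp
    qed
    moreover have "\<nu> = \<nu>'" if "x = Recol i \<kappa> \<nu>" "y = Recol i \<kappa> \<nu>'" for i \<kappa> \<nu> \<nu>'
    proof -
      from dec(1) that obtain e where 1: "s' \<notin> Lv" "\<kappa> = c (s' @ [i]) e" "\<nu> = c s' e" "tup (s' @ [i]) e"
        by (auto simp: dec_Recol)
      from dec(2) that obtain e' where 2: "\<kappa> = c (s' @ [i]) e'" "\<nu>' = c s' e'" "tup (s' @ [i]) e'"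
        by (auto simp: dec_Recol)
      show ?thesis using c_child[OF 1(1,4) 2(3)] 1 2 by simp
    qed
    ultimately show ?thesis unfolding incompatible_def by blast
  qed
qed

section \<open>The instance represented by the new tree\<close>

lemma colored_new_tree_imp:
  assumes "colored \<Sigma> L new_tree (False # s) \<kappa> t"
  shows "\<exists>e. tup s e \<and> \<kappa> = c s e \<and> t = map new_ent e"
  using assms
proof (induction "False # s" \<kappa> t arbitrary: s)
  case (const d i)
  then have s: "s \<in> P" "F s = Const d" by (auto simp: dec_DConst)
  then have "tup s (replicate i s)" using const P by (auto simp: tup_def below_leaf)
  moreover then have "leaf_color L i = c s (replicate i s)" using c_leaf[of s] s P by auto
  moreover have "replicate i (Const d) = map new_ent (replicate i s)" using s by (simp add: new_ent_def)
  ultimately show ?case by blast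
next
  case (star i)
  then obtain n where s: "s \<in> P" "F s = Null n" by (auto simp: dec_Star)
  then have "tup s (replicate i s)" using star P by (auto simp: tup_def below_leaf)
  moreover then have "leaf_color L i = c s (replicate i s)" using c_leaf[of s] s P by auto
  moreover have "replicate i (Null (False # s)) = map new_ent (replicate i s)" using s by (simp add: new_ent_def)
  ultimately show ?case by blast
next
  case (add \<kappa> \<mu> I \<nu> as bs)
  obtain e0 where e0: "tup (s @ [False]) e0" "\<kappa> = c (s @ [False]) e0" "as = map new_ent e0"
    using add.hyps(4) by auto
  obtain e1 where e1: "tup (s @ [True]) e1" "\<mu> = c (s @ [True]) e1" "bs = map new_ent e1"
    using add.hyps(6) by auto
  \<comment> \<open>The instruction was created for \<open>as'\<close> and \<open>bs'\<close>, not
    for the tuples \<open>e0\<close> and \<open>e1\<close> found by induction;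
    \<open>c_merge\<close> shows that both merges have the same color.\<close>
  from add.hyps(2) obtain as' bs' where *: "s \<notin> Lv" "\<kappa> = c (s @ [False]) as'" "\<mu> = c (s @ [True]) bs'"
    "\<nu> = c s (merge I as' bs')" "tup (s @ [False]) as'" "tup (s @ [True]) bs'"
    "length as' + length bs' \<le> max_arity \<Sigma>" "I \<subseteq> {1..length as' + length bs'}" "card I = length as'"
    by (auto simp: dec_Add)
  have len: "length e0 = length as'" "length e1 = length bs'"
    using c_color * e0 e1 by metis+
  have "\<nu> = c s (merge I e0 e1)"
    using c_merge[OF *(1,5) e0(1) *(6) e1(1) _ _ *(7-9)] * e0 e1 by simp
  moreover have "tup s (merge I e0 e1)" using tup_merge[OF e0(1) e1(1)] len * by simp
  moreover have "merge I as bs = map new_ent (merge I e0 e1)"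
    unfolding e0(3) e1(3) by (rule map_merge[OF *(8,9) len, symmetric])
  ultimately show ?case by blast
next
  case (recol i \<kappa> \<nu> t)
  then obtain e where e: "tup (s @ [i]) e" "\<kappa> = c (s @ [i]) e" "t = map new_ent e" by auto
  from recol.hyps(2) obtain e' where "s \<notin> Lv" "\<kappa> = c (s @ [i]) e'" "\<nu> = c s e'" "tup (s @ [i]) e'"
    by (auto simp: dec_Recol)
  then show ?case using e c_child tup_child by metis
next
  case (keep i \<nu> t)
  then obtain e where e: "tup (s @ [i]) e" "\<nu> = c (s @ [i]) e" by auto
  then have "s \<notin> Lv" using below_leaf_child[of s i] by (auto simp: tup_def)
  \<comment> \<open>This contradicts the premise of \<open>keep\<close>, so the case is
    vacuous.\<close>
  then have "Instr (Recol i \<nu> (c s e)) \<in> dec s" using e by (auto simp: dec_Recol)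
  then show ?case using keep by simp
qed

lemma tup_colored_leaf:
  assumes "tup s e" "s \<in> Lv"
  shows "colored \<Sigma> L new_tree (False # s) (c s e) (map new_ent e)"
proof -
  have e: "set e \<subseteq> {s}" "e \<noteq> []" and i: "length e \<in> {1..max_arity \<Sigma>}"
    using assms by (auto simp: tup_def below_leaf Suc_le_eq)
  moreover have "s \<in> P" using e assms(1) by (cases e) (auto simp: tup_def)
  ultimately have e': "map new_ent e = replicate (length e) (new_ent s)"
    by (auto intro!: replicate_eqI)
  show ?thesis
  proof (cases "F s")
    case (Const d)
    then show ?thesis
      unfolding c_leaf[OF assms(2,1)] e' using \<open>s \<in> P\<close> colored.const[of d new_tree "False # s" _ \<Sigma> L] i
      by (simp add: dec_DConst new_ent_def)
  next
    case (Null n)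
    then show ?thesis
      unfolding c_leaf[OF assms(2,1)] e' using \<open>s \<in> P\<close> colored.star[of new_tree "False # s" _ \<Sigma> L] i
      by (simp add: dec_Star new_ent_def)
  qed
qed

text \<open>Induction on \<open>n\<close>, a bound on the depth below \<open>s\<close> of the leaves
  in the tuple. Such a bound exists even in a tree with infinite branches, because a tuple has
  finitely many entries.\<close>

lemma tup_colored:
  assumes "tup s e" "\<forall>l\<in>set e. length l \<le> length s + n"
  shows "colored \<Sigma> L new_tree (False # s) (c s e) (map new_ent e)"
  using assms
proof (induction n arbitrary: s e)
  case (0 s e)
  then obtain l where l: "l \<in> set e" "l \<in> P \<inter> below s" by (cases e) (auto simp: tup_def)
  with 0 have "length l \<le> length s" by auto
  \<comment> \<open>A leaf below \<open>s\<close> that is no longer than \<open>s\<close> is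
    \<open>s\<close> itself.\<close>
  with l P have "s \<in> Lv" by (auto simp: below_def)
  then show ?case by (rule tup_colored_leaf[OF 0(1)])
next
  case (Suc n s e)
  show ?case
  proof (cases "s \<in> Lv")
    case False
    have nl: "\<not> pseudoleaf new_tree (False # s)" using False P by auto
    have IH: "colored \<Sigma> L new_tree ((False # s) @ [i]) (c (s @ [i]) e') (map new_ent e')"
      if "tup (s @ [i]) e'" "set e' \<subseteq> set e" for i e'
      using Suc.IH[OF that(1)] Suc.prems(2) that(2) by auto
    have recol: ?thesis if "tup (s @ [i]) e" for i
    proof (rule colored.recol[OF nl _ IH[OF that subset_refl]])
      show "Instr (Recol i (c (s @ [i]) e) (c s e)) \<in> new_tree (False # s)"
        using that False by (auto simp: dec_Recol)
    qed
    \<comment> \<open>If one part is empty, the tuple lies below a single child and is passed up by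
      \<open>Recol\<close>; otherwise \<open>Add\<close> joins the parts.\<close>
    obtain I as bs where *: "e = merge I as bs" "I \<subseteq> {1..length as + length bs}" "card I = length as"
      "\<forall>x\<in>set as. x \<in> below (s @ [False])" "\<forall>x\<in>set bs. x \<notin> below (s @ [False])"
      by (rule merge_partition[of e "\<lambda>l. l \<in> below (s @ [False])"])
    have set_e: "set e = set as \<union> set bs" unfolding *(1) by (rule set_merge[OF *(2,3)]) auto
    have len: "length as + length bs \<le> max_arity \<Sigma>" using Suc.prems(1) *(1) by (auto simp: tup_def)
    have sub: "set e \<subseteq> P \<inter> below s" "e \<noteq> []" using Suc.prems(1) by (auto simp: tup_def)
    have as: "tup (s @ [False]) as" if "as \<noteq> []" using that * sub set_e len by (auto simp: tup_def)
    have bs: "tup (s @ [True]) bs" if "bs \<noteq> []"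
      using that * sub set_e len below_nonleaf[OF False] by (auto simp: tup_def)
    consider "as = []" | "bs = []" | "as \<noteq> []" "bs \<noteq> []" by blast
    then show ?thesis
    proof cases
      case 1
      then have "bs \<noteq> []" using sub(2) set_e by auto
      then have "tup (s @ [True]) e" using bs set_e 1 len Suc.prems(1) by (auto simp: tup_def)
      then show ?thesis by (rule recol)
    next
      case 2
      then have "as \<noteq> []" using sub(2) set_e by auto
      then have "tup (s @ [False]) e" using as set_e 2 len Suc.prems(1) by (auto simp: tup_def)
      then show ?thesis by (rule recol)
    next
      case 3
      have "Instr (Add (c (s @ [False]) as) (c (s @ [True]) bs) I (c s e)) \<in> new_tree (False # s)"
        using as[OF 3(1)] bs[OF 3(2)] *(1-3) len False by (auto simp: dec_Add)
      then have "colored \<Sigma> L new_tree (False # s) (c s e) (merge I (map new_ent as) (map new_ent bs))"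
        using IH as[OF 3(1)] bs[OF 3(2)] set_e by (intro colored.add[OF nl]) auto
      moreover have "merge I (map new_ent as) (map new_ent bs) = map new_ent e"
        unfolding *(1) by (rule map_merge[OF *(2,3), symmetric]) auto
      ultimately show ?thesis by simp
    qed
  qed (rule tup_colored_leaf[OF Suc.prems(1)])
qed

lemma represented_new_tree:
  "represented \<Sigma> L new_tree = {(R, map new_ent e) | R e. set e \<subseteq> P \<and> (R, map F e) \<in> A}" (is "_ = ?A")
proof
  show "represented \<Sigma> L new_tree \<subseteq> ?A"
    unfolding represented_def
  proof (rule UN_least)
    fix s
    consider "s = []" | s' where "s = False # s'" "s' \<in> P" | s' where "s = False # s'" "s' \<notin> P"
      | s' where "s = True # s'"
      by (metis (full_types) list.exhaust)
    then show "atoms_at \<Sigma> L new_tree s \<subseteq> ?A"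
    proof cases
      case 1
      show ?thesis
      proof
        fix a assume "a \<in> atoms_at \<Sigma> L new_tree s"
        then obtain R t e where a: "a = (R, t)" "tup [] e" "(R, map F e) \<in> A"
          "colored \<Sigma> L new_tree [False] (c [] e) t"
          using 1 by (auto simp: atoms_at_def)
        then obtain e' where e': "tup [] e'" "c [] e = c [] e'" "t = map new_ent e'"
          using colored_new_tree_imp by blast
        \<comment> \<open>The tuple \<open>e'\<close> found in the tree may differ from
          \<open>e\<close>, but it has the same root color, so \<open>c_root\<close> transfers the
          atom.\<close>
        then show "a \<in> ?A" using c_root[OF a(2) e'(1,2) a(3)] a(1) by (auto simp: tup_def)
      qed
    next
      case 2
      then have "atoms_at \<Sigma> L new_tree s \<subseteq> {(top_sym \<Sigma>, map new_ent [s'])}"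
        by (auto simp: atoms_at_def dec_DConst dec_Star new_ent_def)
      moreover have "(top_sym \<Sigma>, map new_ent [s']) \<in> ?A"
        using 2 top_A[of s'] by (intro CollectI exI[of _ "top_sym \<Sigma>"] exI[of _ "[s']"]) auto
      ultimately show ?thesis by blast
    qed (auto simp: atoms_at_def dec_RAdd dec_Mat)
  qed
  show "?A \<subseteq> represented \<Sigma> L new_tree"
  proof
    fix a assume "a \<in> ?A"
    then obtain R e where a: "a = (R, map new_ent e)" "set e \<subseteq> P" "(R, map F e) \<in> A" by blast
    have tup: "tup [] e" using A_tup a by blast
    have "\<forall>l\<in>set e. length l \<le> length ([] :: node) + Max (length ` set e)" by simp
    from tup_colored[OF tup this] have "a \<in> atoms_at \<Sigma> L new_tree []"
      using a tup by (auto simp: atoms_at_def)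
    then show "a \<in> represented \<Sigma> L new_tree" by (auto simp: represented_def)
  qed
qed

lemma isomorphic_new_tree: "isomorphic A (represented \<Sigma> L new_tree)"
proof -
  define h where "h t = (case t of Const d \<Rightarrow> Const d | Null n \<Rightarrow> new_ent (inv_into P F t))" for t
  have hF: "h (F l) = new_ent l" if "l \<in> P" for l
    using that inj_F by (cases "F l") (auto simp: h_def new_ent_def dest: inv_into_f_f)
  have h_Const: "h (Const d) = Const d" for d by (simp add: h_def)
  have adom_A: "adom A = F ` P"
  proof
    show "adom A \<subseteq> F ` P" unfolding adom_def using A by fastforce
    show "F ` P \<subseteq> adom A" unfolding adom_def using top_A by force
  qed
  have img: "(\<lambda>(R, ts). (R, map h ts)) ` A = represented \<Sigma> L new_tree"
    unfolding represented_new_tree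
  proof (intro equalityI subsetI)
    fix a assume "a \<in> (\<lambda>(R, ts). (R, map h ts)) ` A"
    then obtain R ts where ts: "(R, ts) \<in> A" "a = (R, map h ts)" by auto
    then have "ts \<in> lists (F ` P)" using A[OF ts(1)] by auto
    then obtain e where "e \<in> lists P" "ts = map F e" unfolding lists_image by blast
    moreover then have "map h ts = map new_ent e" by (auto simp: hF)
    ultimately have "a = (R, map new_ent e)" "set e \<subseteq> P" "(R, map F e) \<in> A"
      using ts by auto
    then show "a \<in> {(R, map new_ent e) | R e. set e \<subseteq> P \<and> (R, map F e) \<in> A}" by blast
  next
    fix a assume "a \<in> {(R, map new_ent e) | R e. set e \<subseteq> P \<and> (R, map F e) \<in> A}"
    then obtain R e where a: "a = (R, map new_ent e)" "set e \<subseteq> P" "(R, map F e) \<in> A" by blast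
    then have "map new_ent e = map h (map F e)" using hF by auto
    then show "a \<in> (\<lambda>(R, ts). (R, map h ts)) ` A" 
      using a by (intro image_eqI[of _ _ "(R, map F e)"]) simp_all
  qed
  have "adom (represented \<Sigma> L new_tree) = h ` adom A"
    unfolding img[symmetric] adom_def by force
  then have "h ` (adom A \<union> range Const) = adom (represented \<Sigma> L new_tree) \<union> range Const"
    by (auto simp: image_Un image_image h_Const)
  moreover have "inj_on h (adom A \<union> range Const)"
  proof (rule inj_onI)
    \<comment> \<open>A null in the image contains the node of its leaf \<open>l\<close>, from which
      the preimage \<open>F l\<close> is recovered; this yields injectivity.\<close>
    have char: "(\<exists>d. t = Const d \<and> h t = Const d) \<or> (\<exists>l. F l = t \<and> h t = Null (False # l))"
      if t: "t \<in> F ` P \<union> range Const" for t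
    proof (cases t)
      case (Null n)
      then have "t \<in> F ` P" using t by auto
      then obtain l where l: "t = F l" "l \<in> P" by (rule imageE)
      moreover have "new_ent l = Null (False # l)" using l(1)[symmetric] Null by (simp add: new_ent_def)
      ultimately have "F l = t \<and> h t = Null (False # l)" using hF by simp
      then show ?thesis by blast
    qed (simp add: h_Const)
    fix t t' assume "t \<in> adom A \<union> range Const" "t' \<in> adom A \<union> range Const" and eq: "h t = h t'"
    from this(1,2)[unfolded adom_A, THEN char] show "t = t'"
      using eq by (elim disjE exE conjE) simp_all
  qed
  ultimately show ?thesis
    unfolding isomorphic_def bij_betw_def using h_Const img by blast
qed

end

subsection \<open>Definable relations and their quotients\<close>

context tree_model
begin

text \<open>The valuations attached to tuples. Constants are parameters independent of
  \<open>e\<close>, and an index without an entry is valued by the empty set, so that a partial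
  tuple is one with absent entries.\<close>

definition tval :: "node list \<Rightarrow> 'c mso_term + nat \<Rightarrow> node set" where
  "tval e v = (case v of
     Inl (V i) \<Rightarrow> if i < length e then {e ! i} else {}
   | Inl (K c) \<Rightarrow> {l \<in> leaves. g l = Const c}
   | Inr X \<Rightarrow> {})"

lemma tval_simps [simp]:
  "tval e (Inl (V i)) = (if i < length e then {e ! i} else {})"
  "tval e (Inl (K c)) = {l \<in> leaves. g l = Const c}" "tval e (Inr X) = {}"
  by (simp_all add: tval_def)

fun rename :: "(nat \<Rightarrow> nat) \<Rightarrow> 'c mso_term + nat \<Rightarrow> 'c mso_term + nat" where
  "rename \<pi> (Inl (V i)) = Inl (V (\<pi> i))"
| "rename \<pi> v = v"

lemma tval_rename_cong:
  assumes "\<And>i. tval e (Inl (V (\<pi> i))) \<inter> S = tval e' (Inl (V (\<pi>' i))) \<inter> S"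
  shows "tval e (rename \<pi> v) \<inter> S = tval e' (rename \<pi>' v) \<inter> S"
  using assms by (cases "(\<pi>, v)" rule: rename.cases) auto

definition definable :: "nat \<Rightarrow> (node list \<Rightarrow> bool) \<Rightarrow> bool" where
  "definable k W \<longleftrightarrow> (\<exists>Q. recog Q \<and> (\<forall>e. set e \<subseteq> leaves \<longrightarrow> length e = k \<longrightarrow> (W e \<longleftrightarrow> Q (tval e))))"

lemma definable_cong:
  assumes "definable k W" "\<And>e. set e \<subseteq> leaves \<Longrightarrow> length e = k \<Longrightarrow> W e \<longleftrightarrow> W' e"
  shows "definable k W'"
  using assms unfolding definable_def by metis

lemma definable_conj:
  assumes "definable k W" "definable k W'"
  shows "definable k (\<lambda>e. W e \<and> W' e)"
proof -
  from assms obtain Q Q' where "recog Q" "recog Q'"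
    "\<forall>e. set e \<subseteq> leaves \<longrightarrow> length e = k \<longrightarrow> (W e \<longleftrightarrow> Q (tval e))"
    "\<forall>e. set e \<subseteq> leaves \<longrightarrow> length e = k \<longrightarrow> (W' e \<longleftrightarrow> Q' (tval e))"
    unfolding definable_def by blast
  then show ?thesis
    unfolding definable_def by (intro exI[of _ "\<lambda>\<gamma>. Q \<gamma> \<and> Q' \<gamma>"]) (simp add: recog_conj)
qed

lemma definable_exists:
  assumes "definable (Suc n) W"
  shows "definable n (\<lambda>e. \<exists>l\<in>leaves. W (e @ [l]))"
proof -
  from assms obtain Q where Q: "recog Q"
    "\<And>e. set e \<subseteq> leaves \<Longrightarrow> length e = Suc n \<Longrightarrow> W e \<longleftrightarrow> Q (tval e)"
    unfolding definable_def by blast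
  have "(\<exists>l\<in>leaves. W (e @ [l])) \<longleftrightarrow> (\<exists>l\<in>leaves. Q ((tval e)(Inl (V n) := {l})))"
    if "set e \<subseteq> leaves" "length e = n" for e
  proof (rule bex_cong[OF refl])
    fix l assume "l \<in> leaves"
    \<comment> \<open>Index \<open>n\<close> lies just beyond \<open>e\<close>, so the bound
      variable takes a slot that \<open>tval e\<close> leaves empty.\<close>
    moreover have "tval (e @ [l]) = (tval e)(Inl (V n) := {l})"
      using that(2) by (auto simp: tval_def nth_append fun_eq_iff split: sum.splits mso_term.splits)
    ultimately show "W (e @ [l]) \<longleftrightarrow> Q ((tval e)(Inl (V n) := {l}))"
      using Q(2)[of "e @ [l]"] that by simp
  qed
  then show ?thesis
    unfolding definable_def using recog_exists[OF Q(1), of "Inl (V n)"] by blast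
qed

lemma definable_rename:
  assumes "definable k W" "\<And>i. i < k \<Longrightarrow> \<pi> i < n"
  shows "definable n (\<lambda>e. W (map (\<lambda>i. e ! \<pi> i) [0..<k]))"
proof -
  from assms(1) obtain Q where Q: "recog Q"
    "\<And>e. set e \<subseteq> leaves \<Longrightarrow> length e = k \<Longrightarrow> W e \<longleftrightarrow> Q (tval e)"
    unfolding definable_def by blast
  \<comment> \<open>Indices from \<open>k\<close> on are redirected to \<open>n\<close>, which has
    no entry in a tuple of length \<open>n\<close>; they are thus valued by the empty set, as for a
    tuple of length \<open>k\<close>.\<close>
  let ?\<pi> = "\<lambda>i. if i < k then \<pi> i else n"
  have "W (map (\<lambda>i. e ! \<pi> i) [0..<k]) \<longleftrightarrow> Q (\<lambda>v. tval e (rename ?\<pi> v))"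
    if "set e \<subseteq> leaves" "length e = n" for e
  proof -
    have "tval e (rename ?\<pi> v) = tval (map (\<lambda>i. e ! \<pi> i) [0..<k]) v" for v
      using assms(2) that(2) by (cases "(?\<pi>, v)" rule: rename.cases) auto
    moreover have "set (map (\<lambda>i. e ! \<pi> i) [0..<k]) \<subseteq> leaves"
      using assms(2) that nth_mem by fastforce
    ultimately show ?thesis using Q(2) by simp
  qed
  then show ?thesis
    unfolding definable_def using recog_rename[OF Q(1), of "rename ?\<pi>"] by blast
qed

lemma definable_models:
  assumes "mso_formula \<Sigma> C k \<phi>"
  shows "definable k (\<lambda>e. models B \<phi> (map g e))"
proof -
  obtain Q where Q: "recog Q" "\<And>\<alpha> \<beta> \<gamma>. agrees \<phi> \<alpha> \<beta> \<gamma> \<Longrightarrow> sat B \<alpha> \<beta> \<phi> \<longleftrightarrow> Q \<gamma>"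
    using recog_mso by blast
  have "agrees \<phi> (\<lambda>i. map g e ! i) (\<lambda>_. {}) (tval e)" if "set e \<subseteq> leaves" "length e = k" for e
  proof -
    have "map g e ! x \<in> adom B \<and> tval e (Inl (V x)) = {l \<in> leaves. g l = map g e ! x}"
      if "x \<in> free_vars \<phi>" for x
    proof -
      have x: "x < length e" "e ! x \<in> leaves"
        using that assms \<open>set e \<subseteq> leaves\<close> \<open>length e = k\<close> nth_mem unfolding mso_formula_def by blast+
      then show ?thesis using g_inj[of _ "e ! x"] g_image by auto
    qed
    then show ?thesis using assms by (simp add: agrees_def mso_formula_def)
  qed
  then have "models B \<phi> (map g e) \<longleftrightarrow> Q (tval e)" if "set e \<subseteq> leaves" "length e = k" for e
    unfolding models_def using Q(2) that by simp
  then show ?thesis unfolding definable_def using Q(1) by blast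
qed

text \<open>Closes a relation under an identification of leaves. The entries are replaced one at a
  time, in the order of their indices, because \<open>definable_exists\<close> binds a single entry;
  \<open>W' j\<close> allows the first \<open>j\<close> entries to change.\<close>

lemma definable_saturate:
  assumes W: "definable k W" and eq: "definable 2 (\<lambda>e. eq (e ! 0) (e ! 1))"
  shows "definable k (\<lambda>e. \<exists>e'. length e' = k \<and> set e' \<subseteq> leaves \<and> (\<forall>i<k. eq (e ! i) (e' ! i)) \<and> W e')"
proof -
  define W' where "W' j e \<longleftrightarrow> (\<exists>e'. length e' = k \<and> set e' \<subseteq> leaves \<and>
    (\<forall>i<k. if i < j then eq (e ! i) (e' ! i) else e' ! i = e ! i) \<and> W e')" for j e
  have "definable k (W' j)" if "j \<le> k" for j
    using that
  proof (induction j)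
    case 0
    have "W e \<longleftrightarrow> W' 0 e" if "set e \<subseteq> leaves" "length e = k" for e
    proof -
      have "e' = e" if "length e' = k" "\<forall>i<k. e' ! i = e ! i" for e'
        using that \<open>length e = k\<close> by (simp add: nth_equalityI)
      then show ?thesis unfolding W'_def using that by auto
    qed
    then show ?case by (rule definable_cong[OF W])
  next
    case (Suc j)
    \<comment> \<open>The newly bound entry has index \<open>k\<close>: \<open>?p\<close>
      substitutes it for entry \<open>j\<close>, and \<open>?q\<close> pairs the old entry
      \<open>j\<close> with it.\<close>
    let ?p = "\<lambda>i. if i = j then k else i" and ?q = "\<lambda>i. if i = 0 then j else k"
    have "definable (Suc k) (\<lambda>e. W' j (map (\<lambda>i. e ! ?p i) [0..<k]))"
      using Suc by (intro definable_rename) auto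
    moreover have "definable (Suc k) (\<lambda>e. (\<lambda>e. eq (e ! 0) (e ! 1)) (map (\<lambda>i. e ! ?q i) [0..<2]))"
      using Suc.prems by (intro definable_rename[OF eq]) auto
    ultimately have def: "definable k (\<lambda>e. \<exists>l\<in>leaves. W' j (map (\<lambda>i. (e @ [l]) ! ?p i) [0..<k]) \<and>
        eq (map (\<lambda>i. (e @ [l]) ! ?q i) [0..<2] ! 0) (map (\<lambda>i. (e @ [l]) ! ?q i) [0..<2] ! 1))"
      by (intro definable_exists definable_conj)
    have "(\<exists>l\<in>leaves. W' j (map (\<lambda>i. (e @ [l]) ! ?p i) [0..<k]) \<and>
        eq (map (\<lambda>i. (e @ [l]) ! ?q i) [0..<2] ! 0) (map (\<lambda>i. (e @ [l]) ! ?q i) [0..<2] ! 1)) \<longleftrightarrow>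
      W' (Suc j) e" if e: "set e \<subseteq> leaves" "length e = k" for e
    proof -
      have upd: "map (\<lambda>i. (e @ [l]) ! ?p i) [0..<k] = e[j := l]" for l
        using e by (intro nth_equalityI) (auto simp: nth_append nth_list_update)
      have q: "map (\<lambda>i. (e @ [l]) ! ?q i) [0..<2] ! 0 = e ! j"
        "map (\<lambda>i. (e @ [l]) ! ?q i) [0..<2] ! 1 = l" for l
        using e Suc.prems by (auto simp: nth_append)
      have "(\<exists>l\<in>leaves. W' j (e[j := l]) \<and> eq (e ! j) l) \<longleftrightarrow> W' (Suc j) e"
      proof
        assume "\<exists>l\<in>leaves. W' j (e[j := l]) \<and> eq (e ! j) l"
        then obtain l e' where l: "eq (e ! j) l" and e': "length e' = k" "set e' \<subseteq> leaves" "W e'"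
          "\<forall>i<k. if i < j then eq (e[j := l] ! i) (e' ! i) else e' ! i = e[j := l] ! i"
          unfolding W'_def by blast
        have "if i < Suc j then eq (e ! i) (e' ! i) else e' ! i = e ! i" if "i < k" for i
          using e'(4)[rule_format, OF that] l e(2) that by (cases i j rule: linorder_cases) auto
        then show "W' (Suc j) e" unfolding W'_def using e' by blast
      next
        assume "W' (Suc j) e"
        then obtain e' where e': "length e' = k" "set e' \<subseteq> leaves" "W e'"
          "\<forall>i<k. if i < Suc j then eq (e ! i) (e' ! i) else e' ! i = e ! i"
          unfolding W'_def by blast
        have j: "j < k" using Suc.prems by simp
        have "if i < j then eq (e[j := e' ! j] ! i) (e' ! i) else e' ! i = e[j := e' ! j] ! i" if "i < k" for i
          using e'(4)[rule_format, OF that] e(2) that by (cases i j rule: linorder_cases) auto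
        then have "W' j (e[j := e' ! j])" unfolding W'_def using e' by blast
        moreover have "eq (e ! j) (e' ! j)" using e'(4)[rule_format, OF j] by simp
        moreover have "e' ! j \<in> leaves" using e'(1,2) j nth_mem by blast
        ultimately show "\<exists>l\<in>leaves. W' j (e[j := l]) \<and> eq (e ! j) l" by blast
      qed
      then show ?thesis unfolding upd q .
    qed
    then show ?case by (rule definable_cong[OF def])
  qed
  from this[of k] show ?thesis
    by (rule definable_cong[OF _]) (auto simp: W'_def)
qed

end

subsection \<open>Interpreted instances\<close>

lemma isomorphic_trans:
  assumes "isomorphic I J" "isomorphic J H"
  shows "isomorphic I H"
proof -
  from assms obtain h h' where
    h: "bij_betw h (adom I \<union> range Const) (adom J \<union> range Const)" "\<And>c. h (Const c) = Const c"
      "(\<lambda>(R, ts). (R, map h ts)) ` I = J"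
    and h': "bij_betw h' (adom J \<union> range Const) (adom H \<union> range Const)" "\<And>c. h' (Const c) = Const c"
      "(\<lambda>(R, ts). (R, map h' ts)) ` J = H"
    unfolding isomorphic_def by blast
  have "(\<lambda>(R, ts). (R, map (h' \<circ> h) ts)) ` I = H"
    unfolding h(3)[symmetric] h'(3)[symmetric] image_image by (simp add: case_prod_unfold)
  then show ?thesis
    unfolding isomorphic_def using bij_betw_trans[OF h(1) h'(1)] h(2) h'(2)
    by (intro exI[of _ "h' \<circ> h"]) simp
qed

section \<open>Colors from types, and the tree of an interpreted instance\<close>

context tree_model
begin

text \<open>A color is the length of a tuple together with a table of types. Merging respects colors
  since every placement of a merged tuple splits into placements of its two parts, whose types at
  the children are listed in the tables.\<close>

lemma tuple_colors:
  fixes m :: nat and \<rho> :: "node \<Rightarrow> ('c mso_term + nat \<Rightarrow> node set) \<Rightarrow> nat"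
  defines "tup \<equiv> \<lambda>s e. set e \<subseteq> below s \<and> e \<noteq> [] \<and> length e \<le> m"
  assumes \<rho>: "compositional \<rho>"
  obtains M :: "nat coloring" and c :: "node \<Rightarrow> node list \<Rightarrow> nat"
  where "finite (colors M)" "\<And>\<kappa>. \<kappa> \<in> colors M \<Longrightarrow> 1 \<le> color_arity M \<kappa>"
    "\<And>i. i \<in> {1..m} \<Longrightarrow> leaf_color M i \<in> colors M \<and> color_arity M (leaf_color M i) = i"
    "\<And>s e. tup s e \<Longrightarrow> c s e \<in> colors M \<and> color_arity M (c s e) = length e"
    "\<And>s e. s \<in> leaves \<Longrightarrow> tup s e \<Longrightarrow> c s e = leaf_color M (length e)"
    "\<And>s i e e'. s \<notin> leaves \<Longrightarrow> tup (s @ [i]) e \<Longrightarrow> tup (s @ [i]) e' \<Longrightarrow>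
      c (s @ [i]) e = c (s @ [i]) e' \<Longrightarrow> c s e = c s e'"
    "\<And>s as as' bs bs' I. s \<notin> leaves \<Longrightarrow> tup (s @ [False]) as \<Longrightarrow> tup (s @ [False]) as' \<Longrightarrow>
      tup (s @ [True]) bs \<Longrightarrow> tup (s @ [True]) bs' \<Longrightarrow>
      c (s @ [False]) as = c (s @ [False]) as' \<Longrightarrow> c (s @ [True]) bs = c (s @ [True]) bs' \<Longrightarrow>
      length as + length bs \<le> m \<Longrightarrow> I \<subseteq> {1..length as + length bs} \<Longrightarrow> card I = length as \<Longrightarrow>
      c s (merge I as bs) = c s (merge I as' bs')"
    "\<And>e e'. tup [] e \<Longrightarrow> tup [] e' \<Longrightarrow> c [] e = c [] e' \<Longrightarrow>
      length e = length e' \<and> \<rho> [] (tval e) = \<rho> [] (tval e')"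
proof -
  \<comment> \<open>Index \<open>i\<close> of the complete tuple reads entry \<open>\<pi> i\<close>
    of the partial one. The constant value outside \<open>{..<m}\<close> makes \<Pi> finite.\<close>
  define \<Pi> where "\<Pi> = {\<pi>. \<forall>i. (i \<in> {..<m} \<longrightarrow> \<pi> i \<in> {..m}) \<and> (i \<notin> {..<m} \<longrightarrow> \<pi> i = m)}"
  define X where "X = {\<rho> s \<gamma> | s \<gamma>. True}"
  have fin: "finite \<Pi>" "finite X"
    unfolding \<Pi>_def using finite_set_of_finite_funs[of "{..<m}" "{..m}" m] \<rho>
    by (simp_all add: X_def compositional_def)
  \<comment> \<open>The positions of a partial tuple in the final tuple are not yet known, so its color records
    the types for all placements \<open>\<pi>\<close>; the index \<open>m\<close> marks absent entries.\<close>
  define table where "table s e = (\<lambda>\<pi>. (\<pi>, \<rho> s (\<lambda>v. tval e (rename \<pi> v)))) ` \<Pi>" for s e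
  \<comment> \<open>\<open>None\<close> is reserved for the distinguished colors, which carry no
    table.\<close>
  define Col where "Col = {1..m} \<times> insert None (Some ` Pow (\<Pi> \<times> X))"
  have "finite Col" unfolding Col_def using fin by simp
  then obtain enc :: "_ \<Rightarrow> nat" where enc: "inj_on enc Col"
    using finite_imp_inj_to_nat_seg[of Col] by auto
  define raw where "raw s e = (length e, if s \<in> leaves then None else Some (table s e))" for s e
  define c where "c s e = enc (raw s e)" for s e
  define M where "M = \<lparr>colors = enc ` Col, color_arity = \<lambda>\<kappa>. fst (inv_into Col enc \<kappa>),
    leaf_color = \<lambda>i. enc (i, None)\<rparr>"
  have table_iff: "table s e = table s e' \<longleftrightarrow>
      (\<forall>\<pi>\<in>\<Pi>. \<rho> s (\<lambda>v. tval e (rename \<pi> v)) = \<rho> s (\<lambda>v. tval e' (rename \<pi> v)))" for s e e'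
    unfolding table_def by (auto simp: set_eq_iff image_iff)
  have raw_Col: "raw s e \<in> Col" if "tup s e" for s e
    using that by (auto simp: raw_def Col_def tup_def table_def X_def Suc_le_eq)
  have c_iff: "c s e = c s' e' \<longleftrightarrow> raw s e = raw s' e'" if "tup s e" "tup s' e'" for s s' e e'
    unfolding c_def by (rule inj_on_eq_iff[OF enc]) (use raw_Col that in auto)
  \<comment> \<open>A color at a leaf contains no table, but the only tuple of a given length there
    is constant, so the length alone determines the table.\<close>
  have color_iff: "c s e = c s e' \<longleftrightarrow> length e = length e' \<and> table s e = table s e'"
    if "tup s e" "tup s e'" for s e e'
  proof (cases "s \<in> leaves")
    case True
    then have "e = replicate (length e) s" "e' = replicate (length e') s"
      using that by (auto simp: tup_def below_leaf intro!: replicate_eqI)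
    then have "length e = length e' \<Longrightarrow> e = e'" by metis
    then show ?thesis using True c_iff[OF that] by (auto simp: raw_def)
  qed (auto simp: raw_def c_iff[OF that])
  have tup_child: "tup s e" if "tup (s @ [i]) e" for s i e
    using that below_subset(1) unfolding tup_def by blast
  have out: "tval e (Inl (V i)) \<inter> below (s @ [j]) = {}" if "tup (s @ [i']) e" "j \<noteq> i'" for s i' e i j
  proof -
    have "e ! i \<in> below (s @ [i'])" if "i < length e"
      using \<open>tup (s @ [i']) e\<close> that nth_mem unfolding tup_def by blast
    then show ?thesis using below_disjoint[of s] \<open>j \<noteq> i'\<close> by (cases j; cases i') auto
  qed
  show thesis
  proof (rule that[of M c])
    show "finite (colors M)" using \<open>finite Col\<close> by (simp add: M_def)
    show "1 \<le> color_arity M \<kappa>" if "\<kappa> \<in> colors M" for \<kappa>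
    proof -
      have "inv_into Col enc \<kappa> \<in> Col" using that by (intro inv_into_into) (simp add: M_def)
      then show ?thesis by (auto simp: M_def Col_def)
    qed
    show "leaf_color M i \<in> colors M \<and> color_arity M (leaf_color M i) = i" if "i \<in> {1..m}" for i
    proof -
      have "(i, None) \<in> Col" using that by (auto simp: Col_def)
      then show ?thesis using inv_into_f_f[OF enc] by (simp add: M_def)
    qed
    show "c s e \<in> colors M \<and> color_arity M (c s e) = length e" if "tup s e" for s e
      using raw_Col[OF that] inv_into_f_f[OF enc raw_Col[OF that]] by (simp add: M_def c_def) (simp add: raw_def)
    show "c s e = leaf_color M (length e)" if "s \<in> leaves" "tup s e" for s e
      using that by (simp add: c_def raw_def M_def)
    show "c s e = c s e'"
      if s: "s \<notin> leaves" and e: "tup (s @ [i]) e" "tup (s @ [i]) e'" and eq: "c (s @ [i]) e = c (s @ [i]) e'"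
      for s i e e'
    proof -
      have len: "length e = length e'" and tab: "table (s @ [i]) e = table (s @ [i]) e'"
        using color_iff[OF e] eq by auto
      have "\<rho> s (\<lambda>v. tval e (rename \<pi> v)) = \<rho> s (\<lambda>v. tval e' (rename \<pi> v))" if "\<pi> \<in> \<Pi>" for \<pi>
      proof -
        have "\<rho> (s @ [j]) (\<lambda>v. tval e (rename \<pi> v)) = \<rho> (s @ [j]) (\<lambda>v. tval e' (rename \<pi> v))" for j
        proof (cases "j = i")
          case True
          then show ?thesis using tab that by (simp add: table_iff)
        next
          case False
          \<comment> \<open>At the other child neither tuple has a visible entry.\<close>
          show ?thesis
            by (intro compositional_local[OF \<rho>] tval_rename_cong) (simp only: out[OF e(1) False] out[OF e(2) False])
        qed
        then show ?thesis by (intro compositional_step[OF \<rho> s]) auto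
      qed
      then show ?thesis using color_iff[of s e e'] tup_child e len by (auto simp: table_iff)
    qed
    show "c s (merge I as bs) = c s (merge I as' bs')"
      if s: "s \<notin> leaves" and as: "tup (s @ [False]) as" "tup (s @ [False]) as'"
        and bs: "tup (s @ [True]) bs" "tup (s @ [True]) bs'"
        and eq: "c (s @ [False]) as = c (s @ [False]) as'" "c (s @ [True]) bs = c (s @ [True]) bs'"
        and le: "length as + length bs \<le> m" and I: "I \<subseteq> {1..length as + length bs}" "card I = length as"
      for s as as' bs bs' I
    proof -
      have len: "length as = length as'" "length bs = length bs'"
        and tab: "table (s @ [False]) as = table (s @ [False]) as'" "table (s @ [True]) bs = table (s @ [True]) bs'"
        using color_iff[OF as] color_iff[OF bs] eq by auto
      have tup_m: "tup s (merge I xs ys)" if "tup (s @ [False]) xs" "tup (s @ [True]) ys"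
        "length xs = length as" "length ys = length bs" for xs ys
      proof -
        have "set (merge I xs ys) = set xs \<union> set ys" by (rule set_merge[OF I that(3,4)])
        moreover have "length (merge I xs ys) \<noteq> 0" using that(1) by (simp add: tup_def)
        ultimately show ?thesis
          using tup_child[OF that(1)] tup_child[OF that(2)] le that(3,4) by (auto simp: tup_def)
      qed
      have "\<rho> s (\<lambda>v. tval (merge I as bs) (rename \<pi> v)) = \<rho> s (\<lambda>v. tval (merge I as' bs') (rename \<pi> v))"
        if \<pi>: "\<pi> \<in> \<Pi>" for \<pi>
      proof -
        let ?n = "length as + length bs"
        \<comment> \<open>Index \<open>i\<close> reads entry \<open>\<pi> i\<close> of the merged
          tuple. That entry belongs to one part, at its rank there, and is absent from the other;
          \<open>Suc\<close> passes from list indices to positions.\<close>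
        define \<pi>0 where "\<pi>0 i = (if \<pi> i < ?n \<and> Suc (\<pi> i) \<in> I then card (I \<inter> {1..<Suc (\<pi> i)}) else m)" for i
        define \<pi>1 where "\<pi>1 i = (if \<pi> i < ?n \<and> Suc (\<pi> i) \<notin> I then card ({1..<Suc (\<pi> i)} - I) else m)" for i
        have r0: "card (I \<inter> {1..<Suc p}) < length as" if "Suc p \<in> I" for p
          using merge_rank_less(1)[OF I that] .
        have r1: "card ({1..<Suc p} - I) < length bs" if "p < ?n" "Suc p \<notin> I" for p
          using merge_rank_less(2)[OF I, of "Suc p"] that by simp
        have "\<pi>0 i \<le> m" "\<pi>1 i \<le> m" "i \<notin> {..<m} \<Longrightarrow> \<pi>0 i = m \<and> \<pi>1 i = m" for i
          using r0[of "\<pi> i"] r1[of "\<pi> i"] le \<pi> by (auto simp: \<pi>0_def \<pi>1_def \<Pi>_def)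
        then have in_\<Pi>: "\<pi>0 \<in> \<Pi>" "\<pi>1 \<in> \<Pi>" by (auto simp: \<Pi>_def)
        have m0: "tval (merge I xs ys) (Inl (V (\<pi> i))) \<inter> below (s @ [False]) =
            tval xs (Inl (V (\<pi>0 i))) \<inter> below (s @ [False])"
          and m1: "tval (merge I xs ys) (Inl (V (\<pi> i))) \<inter> below (s @ [True]) =
            tval ys (Inl (V (\<pi>1 i))) \<inter> below (s @ [True])"
          if xy: "tup (s @ [False]) xs" "tup (s @ [True]) ys" "length xs = length as" "length ys = length bs"
          for xs ys i
        proof -
          have xs: "xs ! k \<in> below (s @ [False])" if "k < length as" for k
            using xy that nth_mem[of k xs] by (auto simp: tup_def)
          have ys: "ys ! k \<in> below (s @ [True])" if "k < length bs" for k
            using xy that nth_mem[of k ys] by (auto simp: tup_def)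
          consider "\<not> \<pi> i < ?n" | "\<pi> i < ?n" "Suc (\<pi> i) \<in> I" | "\<pi> i < ?n" "Suc (\<pi> i) \<notin> I" by blast
          then have "tval (merge I xs ys) (Inl (V (\<pi> i))) \<inter> below (s @ [False]) =
              tval xs (Inl (V (\<pi>0 i))) \<inter> below (s @ [False]) \<and>
            tval (merge I xs ys) (Inl (V (\<pi> i))) \<inter> below (s @ [True]) =
              tval ys (Inl (V (\<pi>1 i))) \<inter> below (s @ [True])"
          proof cases
            case 1
            then show ?thesis using xy(3,4) le by (simp add: \<pi>0_def \<pi>1_def)
          next
            case 2
            then have "merge I xs ys ! \<pi> i = xs ! \<pi>0 i" "\<pi>0 i < length as" "\<pi>1 i = m"
              using xy(3,4) r0 by (simp_all add: merge_nth \<pi>0_def \<pi>1_def)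
            then show ?thesis using xs[of "\<pi>0 i"] 2 xy(3,4) le below_disjoint[of s] by auto
          next
            case 3
            then have "merge I xs ys ! \<pi> i = ys ! \<pi>1 i" "\<pi>1 i < length bs" "\<pi>0 i = m"
              using xy(3,4) r1 by (simp_all add: merge_nth \<pi>0_def \<pi>1_def)
            then show ?thesis using ys[of "\<pi>1 i"] 3 xy(3,4) le below_disjoint[of s] by auto
          qed
          then show "tval (merge I xs ys) (Inl (V (\<pi> i))) \<inter> below (s @ [False]) =
              tval xs (Inl (V (\<pi>0 i))) \<inter> below (s @ [False])"
            "tval (merge I xs ys) (Inl (V (\<pi> i))) \<inter> below (s @ [True]) =
              tval ys (Inl (V (\<pi>1 i))) \<inter> below (s @ [True])" by blast+
        qed
        have \<rho>0: "\<rho> (s @ [False]) (\<lambda>v. tval (merge I xs ys) (rename \<pi> v)) =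
            \<rho> (s @ [False]) (\<lambda>v. tval xs (rename \<pi>0 v))"
          and \<rho>1: "\<rho> (s @ [True]) (\<lambda>v. tval (merge I xs ys) (rename \<pi> v)) =
            \<rho> (s @ [True]) (\<lambda>v. tval ys (rename \<pi>1 v))"
          if "tup (s @ [False]) xs" "tup (s @ [True]) ys" "length xs = length as" "length ys = length bs"
          for xs ys
          by (intro compositional_local[OF \<rho>] tval_rename_cong m0[OF that] m1[OF that])+
        show ?thesis
        proof (rule compositional_step[OF \<rho> s])
          show "\<rho> (s @ [False]) (\<lambda>v. tval (merge I as bs) (rename \<pi> v)) =
              \<rho> (s @ [False]) (\<lambda>v. tval (merge I as' bs') (rename \<pi> v))"
            using \<rho>0[OF as(1) bs(1)] \<rho>0[OF as(2) bs(2)] len tab(1) in_\<Pi>(1) by (simp add: table_iff)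
          show "\<rho> (s @ [True]) (\<lambda>v. tval (merge I as bs) (rename \<pi> v)) =
              \<rho> (s @ [True]) (\<lambda>v. tval (merge I as' bs') (rename \<pi> v))"
            using \<rho>1[OF as(1) bs(1)] \<rho>1[OF as(2) bs(2)] len tab(2) in_\<Pi>(2) by (simp add: table_iff)
        qed
      qed
      then have "table s (merge I as bs) = table s (merge I as' bs')" unfolding table_iff by blast
      then show ?thesis
        using color_iff[OF tup_m[OF as(1) bs(1) refl refl] tup_m[OF as(2) bs(2) len[symmetric]]] len by simp
    qed
    show "length e = length e' \<and> \<rho> [] (tval e) = \<rho> [] (tval e')"
      if "tup [] e" "tup [] e'" "c [] e = c [] e'" for e e'
    proof -
      \<comment> \<open>The identity, cut off at \<open>m\<close> so as to lie in \<Pi>. For tuples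
        of length at most \<open>m\<close> it changes no valuation.\<close>
      let ?id = "\<lambda>i. min i m"
      have id: "?id \<in> \<Pi>" by (auto simp: \<Pi>_def)
      have "tval e (rename ?id v) = tval e v" if "tup [] e" for e v
        using that by (cases "(?id, v)" rule: rename.cases) (auto simp: tup_def min_def)
      then have "(\<lambda>v. tval e (rename ?id v)) = tval e" "(\<lambda>v. tval e' (rename ?id v)) = tval e'"
        using that by auto
      moreover have "length e = length e'" "table [] e = table [] e'"
        using color_iff[OF that(1,2)] that(3) by auto
      ultimately show ?thesis using id unfolding table_iff by metis
    qed
  qed
qed

text \<open>The formula for \<open>R\<close> may distinguish leaves that the equality formula
  identifies. An atom of the result is therefore witnessed by some tuple of equivalent leaves, and
  \<open>definable_saturate\<close> expresses this on representatives.\<close>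

lemma represented_interp_result:
  fixes \<Sigma>' :: "'s signature" and C' :: "'d set"
  assumes sig: "is_signature \<Sigma>'" and J: "mso_interpretation \<Sigma> C \<Sigma>' C' J"
    and A: "interp_result \<Sigma>' C' J B = Some A"
  shows "\<exists>(M :: nat coloring) T'. is_coloring \<Sigma>' M \<and> well_decorated M C' \<Sigma>' T' \<and>
    isomorphic A (represented \<Sigma>' M T')"
proof -
  define D where "D = interp_dom \<Sigma>' J B"
  define f where "f = (SOME f. interp_fun \<Sigma>' C' J B f)"
  define m where "m = max_arity \<Sigma>'"
  have top: "rels \<Sigma>' \<union> {top_sym \<Sigma>'} = rels \<Sigma>'" "arity \<Sigma>' (top_sym \<Sigma>') = 1" "top_sym \<Sigma>' \<in> rels \<Sigma>'"
    using sig by (auto simp: is_signature_def)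
  have ex: "\<exists>f. interp_fun \<Sigma>' C' J B f"
    using A unfolding interp_result_def by (metis option.distinct(1))
  then have f: "interp_fun \<Sigma>' C' J B f" unfolding f_def by (rule someI_ex)
  have A_eq: "A = (\<Union>R\<in>rels \<Sigma>'. {(R, map f ts) | ts. length ts = arity \<Sigma>' R \<and> set ts \<subseteq> D \<and>
      models B (fm_rel J R) ts})"
    using A ex unfolding interp_result_def top(1) f_def[symmetric] D_def[symmetric] by (simp add: Let_def)
  define DL where "DL = {l \<in> leaves. g l \<in> D}"
  define F where "F = f \<circ> g"
  have D_sub: "D \<subseteq> g ` leaves" unfolding g_image D_def interp_dom_def by blast
  then have gDL: "g ` DL = D" unfolding DL_def by auto
  \<comment> \<open>An arbitrary transversal of the identification: \<open>P\<close> only selects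
    the tuples to be colored, while formulas are evaluated over all leaves.\<close>
  obtain P where P: "P \<subseteq> DL" "inj_on F P" "F ` P = F ` DL"
    using subset_image_inj[of "F ` DL" F DL] by auto
  have P_leaves: "P \<subseteq> leaves" using P(1) DL_def by auto
  \<comment> \<open>Membership in \<open>DL\<close> is part of \<open>eq\<close>, so the tuples
    reached by saturation lie in the domain of the interpretation, where \<open>f\<close> is
    constrained.\<close>
  define eq where "eq l l' \<longleftrightarrow> l \<in> DL \<and> l' \<in> DL \<and> F l = F l'" for l l'
  have eq: "definable 2 (\<lambda>e. eq (e ! 0) (e ! 1))"
  proof -
    have 1: "definable 1 (\<lambda>e. models B (fm_rel J (top_sym \<Sigma>')) (map g e))"
      using J top by (intro definable_models) (auto simp: mso_interpretation_def dest!: bspec)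
    have 2: "definable 2 (\<lambda>e. models B (fm_eq J) (map g e))"
      using J by (intro definable_models) (auto simp: mso_interpretation_def)
    have "definable 2 (\<lambda>e. models B (fm_eq J) (map g e) \<and>
        models B (fm_rel J (top_sym \<Sigma>')) (map g (map (\<lambda>i. e ! i) [0..<1])) \<and>
        models B (fm_rel J (top_sym \<Sigma>')) (map g (map (\<lambda>i. e ! Suc i) [0..<1])))"
      by (intro definable_conj 2 definable_rename[OF 1]) auto
    then show ?thesis
    proof (rule definable_cong)
      fix e assume e: "set e \<subseteq> leaves" "length e = 2"
      then obtain l l' where l: "e = [l, l']" "l \<in> leaves" "l' \<in> leaves"
        by (auto simp: length_Suc_conv numeral_2_eq_2)
      have DL: "x \<in> DL \<longleftrightarrow> models B (fm_rel J (top_sym \<Sigma>')) [g x]" if "x \<in> leaves" for x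
        using that g_image unfolding DL_def D_def interp_dom_def by auto
      have "F l = F l' \<longleftrightarrow> models B (fm_eq J) [g l, g l']" if "l \<in> DL" "l' \<in> DL"
        using f that unfolding interp_fun_def D_def[symmetric] F_def DL_def by simp
      then show "(models B (fm_eq J) (map g e) \<and>
        models B (fm_rel J (top_sym \<Sigma>')) (map g (map (\<lambda>i. e ! i) [0..<1])) \<and>
        models B (fm_rel J (top_sym \<Sigma>')) (map g (map (\<lambda>i. e ! Suc i) [0..<1]))) \<longleftrightarrow> eq (e ! 0) (e ! 1)"
        using DL[OF l(2)] DL[OF l(3)] unfolding eq_def l(1) by auto
    qed
  qed
  have A_iff: "(R, map F e) \<in> A \<longleftrightarrow> (\<exists>e'. length e' = arity \<Sigma>' R \<and> set e' \<subseteq> leaves \<and>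
      (\<forall>i<arity \<Sigma>' R. eq (e ! i) (e' ! i)) \<and> models B (fm_rel J R) (map g e'))"
    if R: "R \<in> rels \<Sigma>'" and e: "set e \<subseteq> DL" "length e = arity \<Sigma>' R" for R e
  proof
    assume "(R, map F e) \<in> A"
    then obtain ts where ts: "map F e = map f ts" "length ts = arity \<Sigma>' R" "set ts \<subseteq> D" "models B (fm_rel J R) ts"
      unfolding A_eq by auto
    from ts(3) have "ts \<in> lists (g ` DL)" unfolding gDL by auto
    then obtain e' where e': "set e' \<subseteq> DL" "ts = map g e'" unfolding lists_image by auto
    have len: "length e' = arity \<Sigma>' R" using ts(2) e'(2) by simp
    have "eq (e ! i) (e' ! i)" if "i < arity \<Sigma>' R" for i
    proof -
      have "map F e ! i = map F e' ! i" using ts(1) e'(2) by (simp add: F_def)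
      moreover have "e ! i \<in> DL" "e' ! i \<in> DL" using that e e' len nth_mem by (metis subsetD)+
      ultimately show ?thesis using that e(2) len by (simp add: eq_def)
    qed
    then show "\<exists>e'. length e' = arity \<Sigma>' R \<and> set e' \<subseteq> leaves \<and>
      (\<forall>i<arity \<Sigma>' R. eq (e ! i) (e' ! i)) \<and> models B (fm_rel J R) (map g e')"
      using len e' ts(4) DL_def by blast
  next
    assume "\<exists>e'. length e' = arity \<Sigma>' R \<and> set e' \<subseteq> leaves \<and>
      (\<forall>i<arity \<Sigma>' R. eq (e ! i) (e' ! i)) \<and> models B (fm_rel J R) (map g e')"
    then obtain e' where e': "length e' = arity \<Sigma>' R" "\<And>i. i < arity \<Sigma>' R \<Longrightarrow> eq (e ! i) (e' ! i)"
      "models B (fm_rel J R) (map g e')" by blast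
    have "map F e = map f (map g e')"
      using e' e(2) by (auto simp: list_eq_iff_nth_eq eq_def F_def)
    moreover have "set (map g e') \<subseteq> D"
      using e'(1,2) by (auto simp: in_set_conv_nth eq_def DL_def)
    ultimately show "(R, map F e) \<in> A"
      unfolding A_eq using R e'(1,3) by (intro UN_I[of R] CollectI exI[of _ "map g e'"]) simp_all
  qed
  have "\<exists>Q. recog Q \<and> (\<forall>e. set e \<subseteq> P \<longrightarrow> length e = arity \<Sigma>' R \<longrightarrow> ((R, map F e) \<in> A \<longleftrightarrow> Q (tval e)))"
    if R: "R \<in> rels \<Sigma>'" for R
  proof -
    have "definable (arity \<Sigma>' R) (\<lambda>e. models B (fm_rel J R) (map g e))"
      using J R by (intro definable_models) (auto simp: mso_interpretation_def)
    from definable_saturate[OF this eq] obtain Q where Q: "recog Q"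
      "\<And>e. set e \<subseteq> leaves \<Longrightarrow> length e = arity \<Sigma>' R \<Longrightarrow> (\<exists>e'. length e' = arity \<Sigma>' R \<and>
        set e' \<subseteq> leaves \<and> (\<forall>i<arity \<Sigma>' R. eq (e ! i) (e' ! i)) \<and> models B (fm_rel J R) (map g e')) \<longleftrightarrow>
        Q (tval e)"
      unfolding definable_def by blast
    have "(R, map F e) \<in> A \<longleftrightarrow> Q (tval e)" if "set e \<subseteq> P" "length e = arity \<Sigma>' R" for e
      by (rule trans[OF A_iff[OF R subset_trans[OF that(1) P(1)] that(2)]
            Q(2)[OF subset_trans[OF that(1) P_leaves] that(2)]])
    then show ?thesis using Q(1) by blast
  qed
  then have "\<forall>R\<in>rels \<Sigma>'. \<exists>Q. recog Q \<and>
      (\<forall>e. set e \<subseteq> P \<longrightarrow> length e = arity \<Sigma>' R \<longrightarrow> ((R, map F e) \<in> A \<longleftrightarrow> Q (tval e)))" by blast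
  from bchoice[OF this] obtain Q where Q: "\<And>R. R \<in> rels \<Sigma>' \<Longrightarrow> recog (Q R)"
    "\<And>R e. R \<in> rels \<Sigma>' \<Longrightarrow> set e \<subseteq> P \<Longrightarrow> length e = arity \<Sigma>' R \<Longrightarrow> (R, map F e) \<in> A \<longleftrightarrow> Q R (tval e)"
    by blast
  have fin: "finite (rels \<Sigma>')" using sig by (simp add: is_signature_def)
  obtain \<rho> :: "node \<Rightarrow> ('c mso_term + nat \<Rightarrow> node set) \<Rightarrow> nat"
    where \<rho>: "compositional \<rho>" "\<forall>R\<in>rels \<Sigma>'. decides \<rho> (Q R)"
    using recog_family[where Q = Q, OF fin Q(1)] by blast
  obtain M :: "nat coloring" and c :: "node \<Rightarrow> node list \<Rightarrow> nat"
    where Lc: "finite (colors M)" "\<And>\<kappa>. \<kappa> \<in> colors M \<Longrightarrow> 1 \<le> color_arity M \<kappa>"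
    "\<And>i. i \<in> {1..m} \<Longrightarrow> leaf_color M i \<in> colors M \<and> color_arity M (leaf_color M i) = i"
    "\<And>s e. set e \<subseteq> below s \<and> e \<noteq> [] \<and> length e \<le> m \<Longrightarrow> c s e \<in> colors M \<and> color_arity M (c s e) = length e"
    "\<And>s e. s \<in> leaves \<Longrightarrow> set e \<subseteq> below s \<and> e \<noteq> [] \<and> length e \<le> m \<Longrightarrow> c s e = leaf_color M (length e)"
    "\<And>s i e e'. s \<notin> leaves \<Longrightarrow> set e \<subseteq> below (s @ [i]) \<and> e \<noteq> [] \<and> length e \<le> m \<Longrightarrow>
      set e' \<subseteq> below (s @ [i]) \<and> e' \<noteq> [] \<and> length e' \<le> m \<Longrightarrow>
      c (s @ [i]) e = c (s @ [i]) e' \<Longrightarrow> c s e = c s e'"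
    "\<And>s as as' bs bs' I. s \<notin> leaves \<Longrightarrow> set as \<subseteq> below (s @ [False]) \<and> as \<noteq> [] \<and> length as \<le> m \<Longrightarrow>
      set as' \<subseteq> below (s @ [False]) \<and> as' \<noteq> [] \<and> length as' \<le> m \<Longrightarrow>
      set bs \<subseteq> below (s @ [True]) \<and> bs \<noteq> [] \<and> length bs \<le> m \<Longrightarrow>
      set bs' \<subseteq> below (s @ [True]) \<and> bs' \<noteq> [] \<and> length bs' \<le> m \<Longrightarrow>
      c (s @ [False]) as = c (s @ [False]) as' \<Longrightarrow> c (s @ [True]) bs = c (s @ [True]) bs' \<Longrightarrow>
      length as + length bs \<le> m \<Longrightarrow> I \<subseteq> {1..length as + length bs} \<Longrightarrow> card I = length as \<Longrightarrow>
      c s (merge I as bs) = c s (merge I as' bs')"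
    "\<And>e e'. set e \<subseteq> below [] \<and> e \<noteq> [] \<and> length e \<le> m \<Longrightarrow> set e' \<subseteq> below [] \<and> e' \<noteq> [] \<and> length e' \<le> m \<Longrightarrow>
      c [] e = c [] e' \<Longrightarrow> length e = length e' \<and> \<rho> [] (tval e) = \<rho> [] (tval e')"
    by (rule tuple_colors[OF \<rho>(1), of m]) blast
  \<comment> \<open>The colors are defined for tuples of arbitrary leaves; the new tree uses only
    those with entries in \<open>P\<close>.\<close>
  interpret new: tuple_coloring leaves \<Sigma>' C' M P F A c
    "\<lambda>s e. set e \<subseteq> P \<inter> below s \<and> e \<noteq> [] \<and> length e \<le> max_arity \<Sigma>'"
  proof (unfold_locales, goal_cases)
    case 1 show ?case by (rule sig)
  next
    case 2 show ?case unfolding is_coloring_def m_def[symmetric] using Lc(1-3) by blast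
  next
    case 3 show ?case by (rule P_leaves)
  next
    case (4 s e) then show ?case using Lc(4)[of e s] by (simp add: m_def)
  next
    case (5 s e) then show ?case using Lc(5)[of s e] by (simp add: m_def)
  next
    case (6 s i e e') then show ?case using Lc(6)[of s e i e'] by (simp add: m_def)
  next
    case (7 s as as' bs bs' I) then show ?case using Lc(7)[of s as as' bs bs' I] by (simp add: m_def)
  next
    case (8 e e' R)
    \<comment> \<open>Equal colors include equal lengths, so \<open>e'\<close> has the arity of
      \<open>R\<close> as well and \<open>Q R\<close> applies to both tuples.\<close>
    then have "length e = length e'" "\<rho> [] (tval e) = \<rho> [] (tval e')"
      using Lc(8)[of e e'] by (auto simp: m_def)
    moreover have "R \<in> rels \<Sigma>'" "length e = arity \<Sigma>' R" using 8(4) unfolding A_eq by (auto dest: map_eq_imp_length_eq)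
    ultimately show ?case using Q(2)[of R e] Q(2)[of R e'] decidesD[OF bspec[OF \<rho>(2)], of R "tval e" "tval e'"] 8 by auto
  next
    case 9 show ?case by (rule P(2))
  next
    case 10
    have "F ` DL = f ` D" unfolding gDL[symmetric] F_def by auto
    then show ?case using f P(3) unfolding interp_fun_def D_def by auto
  next
    case (11 l)
    then have "g l \<in> D" using P(1) DL_def by auto
    then show ?case unfolding A_eq using top
      by (auto simp: F_def D_def interp_dom_def intro!: bexI[of _ "top_sym \<Sigma>'"] exI[of _ "[g l]"])
  next
    case (12 R ts)
    have "F ` DL = f ` D" unfolding gDL[symmetric] F_def by auto
    then have "F ` P = f ` D" using P(3) by simp
    then show ?case using 12 unfolding A_eq by (auto simp: subset_eq)
  qed
  show ?thesis
    using new.coloring new.well_decorated_new_tree new.isomorphic_new_tree by blast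
qed

end

theorem mainTheorem5:
  fixes \<Sigma> :: "'r signature" and C :: "'c set" and \<Sigma>' :: "'s signature" and C' :: "'d set"
    and A :: "('s, 'd, null) atoms" and B :: "('r, 'c, null) atoms"
  assumes "is_signature \<Sigma>" and "finite C" and "is_signature \<Sigma>'" and "finite C'"
    and "is_instance \<Sigma>' C' A" and "is_instance \<Sigma> C B"
    and "mso_interpretable \<Sigma> C \<Sigma>' C' A B"
    and "partitionwidth \<Sigma> C B \<in> \<nat>"
  shows "partitionwidth \<Sigma>' C' A \<in> \<nat>"
proof -
  \<comment> \<open>The width is an infimum of sizes and equals \<infinity> exactly if there is no
    tree, so hypothesis and conclusion both amount to the existence of a tree.\<close>
  have "partitionwidth \<Sigma> C B \<noteq> \<infinity>" using assms(8) by (auto simp: Nats_def of_nat_eq_enat)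
  then obtain L :: "nat coloring" and T where LT: "is_coloring \<Sigma> L" "well_decorated L C \<Sigma> T"
    and iso: "isomorphic B (represented \<Sigma> L T)"
  proof -
    have "{enat (card (colors L)) | (L :: nat coloring) T.
        is_coloring \<Sigma> L \<and> well_decorated L C \<Sigma> T \<and> isomorphic B (represented \<Sigma> L T)} \<noteq> {}"
      using \<open>partitionwidth \<Sigma> C B \<noteq> \<infinity>\<close> unfolding partitionwidth_def by (metis Inf_enat_def)
    then show thesis using that by blast
  qed
  interpret decorated_tree \<Sigma> L C T using LT by unfold_locales
  let ?B = "represented \<Sigma> L T"
  from iso obtain h where h: "bij_betw h (adom B \<union> range Const) (adom ?B \<union> range Const)"
    "(\<lambda>(R, ts). (R, map h ts)) ` B = ?B"
    unfolding isomorphic_def by blast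
  have adom_h: "h ` adom B = adom ?B" unfolding h(2)[symmetric] adom_def by force
  have h_adom: "bij_betw h (adom B) (ent ` leaves)"
    using bij_betw_subset[OF h(1) Un_upper1] adom_h adom_represented by simp
  \<comment> \<open>The isomorphism matches the elements of \<open>B\<close> with entities, and
    entities correspond to leaves; \<open>g\<close> is the resulting naming of leaves by
    elements.\<close>
  define g where "g = inv_into (adom B) h \<circ> ent"
  have bij_g: "bij_betw g leaves (adom B)"
    unfolding g_def using bij_betw_trans[OF inj_on_imp_bij_betw[OF inj_on_ent] bij_betw_inv_into[OF h_adom]] .
  have hg: "h (g l) = ent l" if "l \<in> leaves" for l
    using that bij_betw_inv_into_right[OF h_adom] by (simp add: g_def)
  interpret tree_model \<Sigma> L C T B g
  proof
    fix ls R assume ls: "set ls \<subseteq> leaves"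
    then have map_h: "map h (map g ls) = map ent ls" using hg by auto
    show "(R, map g ls) \<in> B \<longleftrightarrow> (R, map ent ls) \<in> ?B"
    proof
      assume "(R, map g ls) \<in> B"
      then show "(R, map ent ls) \<in> ?B" unfolding h(2)[symmetric] using map_h
        by (intro image_eqI[of _ _ "(R, map g ls)"]) simp_all
    next
      assume "(R, map ent ls) \<in> ?B"
      then obtain ts where ts: "(R, ts) \<in> B" "map ent ls = map h ts" unfolding h(2)[symmetric] by auto
      have "set ts \<subseteq> adom B" using ts(1) unfolding adom_def by force
      moreover have "set (map g ls) \<subseteq> adom B" using ls bij_g by (auto simp: bij_betw_def)
      \<comment> \<open>Both lists have the same image under \<open>h\<close>, which is injective on
        the active domain.\<close>
      ultimately have "map g ls = ts"
        using ts(2) map_h h_adom inj_on_map_eq_map[of h "map g ls" ts]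
        by (metis Un_least bij_betw_imp_inj_on inj_on_subset)
      then show "(R, map g ls) \<in> B" using ts(1) by simp
    qed
  qed (rule bij_g)
  from assms(7) obtain J A' where "mso_interpretation \<Sigma> C \<Sigma>' C' J" "interp_result \<Sigma>' C' J B = Some A'"
    "isomorphic A A'" unfolding mso_interpretable_def by blast
  then obtain L' :: "nat coloring" and T' where "is_coloring \<Sigma>' L'" "well_decorated L' C' \<Sigma>' T'"
    "isomorphic A (represented \<Sigma>' L' T')"
    using represented_interp_result[OF assms(3)] isomorphic_trans by blast
  then have "partitionwidth \<Sigma>' C' A \<le> enat (card (colors L'))"
    unfolding partitionwidth_def by (intro Inf_lower) blast
  then obtain n where "partitionwidth \<Sigma>' C' A = enat n" by (cases "partitionwidth \<Sigma>' C' A") auto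
  then show ?thesis by (simp flip: of_nat_eq_enat)
qed

end
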